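(* Let $0<\alpha<1/2$, $T>0$, and let $L:[0,\infty)\to\mathbb{R}$ satisfy: (1) $L$ is twice continuously differentiable on $[0,\infty)$, $L(0)\neq 0$ and $\int_0^\infty |L(s)s^\alpha|^2\,ds<\infty$; (2) there is $\zeta_0>\alpha+3/2$ such that, as $s\uparrow\infty$, $L'(s)=O(s^{-\zeta_0})$ and $L''(s)=O(s^{-(\zeta_0+1)})$. Let $\sigma=(\sigma_t)_{t\in\mathbb{R}}$ be an adapted stationary càglàd process with $\sup_t\mathbb{E}(\sigma_t^2)<\infty$, and let $$Y_t=\int_{-\infty}^tL(t-s)(t-s)^\alpha\sigma_s\,dB_s,\qquad t\in\mathbb{R}.$$ Then for every continuously differentiable function $f:\mathbb{R}\to\mathbb{R}$ whose derivative is Hölder continuous of order $\beta>\frac{1}{\alpha+1/2}-1$, the following Itô formula holds: $$f(Y_T)=f(Y_0)+\int_0^Tf'(Y_s)\,dY_s,$$ where $\int_0^Tf'(Y_s)\,dY_s$ is understood pathwise (as a Young integral).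
   Context: $(\Omega,\mathcal{F},(\mathcal{F}_t)_{t\in\mathbb{R}},\mathbb{P})$ is a filtered probability space satisfying the usual conditions. $B=(B_t)_{t\in\mathbb{R}}$ is a two-sided Brownian motion on it: a continuous centered Gaussian process with $B_0=0$ such that for all $t\ge 0$, $s\in\mathbb{R}$, $B_{t+s}-B_s$ has variance $t$, is $\mathcal{F}_{t+s}$-measurable and is independent of $\mathcal{F}_s$. Càglàd means left-continuous with right limits. $Y$ on $[0,T]$ is taken in a continuous version. Pathwise integral: for a continuous process $Z$, $\int_0^TZ_s\,dY_s$ is the almost sure limit, when it exists and does not depend on the partitions, of the Riemann sums $\sum_{i=0}^{n-1}Z_{t_i^n}(Y_{t_{i+1}^n}-Y_{t_i^n})$, where $0=t_0^n<t_1^n<\cdots<t_n^n=T$ and $\sup_i|t_{i+1}^n-t_i^n|\to0$ as $n\to\infty$. *)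

theory Defs
  imports "HOL-Probability.Probability"
begin

section \<open>Filtered probability spaces and two-sided Brownian motion\<close>

text \<open>Of the measures \<open>F t\<close> only \<open>space\<close> and \<open>sets\<close> are used.\<close>

locale usual_filtered_prob_space =
  prob_space M + complete_measure M + filtration "space M" F
  for M :: "'a measure" and F :: "real \<Rightarrow> 'a measure" +
  assumes sets_F_subset: "\<And>t. sets (F t) \<subseteq> sets M"
    and null_sets_F: "\<And>t. null_sets M \<subseteq> sets (F t)"
    and right_continuous_F: "\<And>t. sets (F t) = (\<Inter>u\<in>{t<..}. sets (F u))"

text \<open>A Gaussian variable may be degenerate, i.e. almost surely constant.\<close>

definition gaussian_rv :: "'a measure \<Rightarrow> ('a \<Rightarrow> real) \<Rightarrow> bool" where
  "gaussian_rv M X \<longleftrightarrow> X \<in> borel_measurable M \<and>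
     (\<exists>\<mu>. (AE \<omega> in M. X \<omega> = \<mu>) \<or> (\<exists>s>0. distributed M lborel X (normal_density \<mu> s)))"

definition gaussian_process :: "'a measure \<Rightarrow> ('i \<Rightarrow> 'a \<Rightarrow> real) \<Rightarrow> bool" where
  "gaussian_process M X \<longleftrightarrow>
     (\<forall>J (c :: 'i \<Rightarrow> real). finite J \<longrightarrow> gaussian_rv M (\<lambda>\<omega>. \<Sum>j\<in>J. c j * X j \<omega>))"

text \<open>Only the increments of \<open>B\<close> are adapted; \<open>B t\<close> itself need not be \<open>F t\<close>-measurable
  for \<open>t < 0\<close>.\<close>

locale two_sided_brownian_motion = usual_filtered_prob_space M F
  for M :: "'a measure" and F :: "real \<Rightarrow> 'a measure" +
  fixes B :: "real \<Rightarrow> 'a \<Rightarrow> real"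
  assumes continuous_B: "\<And>\<omega>. \<omega> \<in> space M \<Longrightarrow> continuous_on UNIV (\<lambda>t. B t \<omega>)"
    and gaussian_B: "gaussian_process M B"
    and centered_B: "\<And>t. expectation (B t) = 0"
    and B_0: "\<And>\<omega>. \<omega> \<in> space M \<Longrightarrow> B 0 \<omega> = 0"
    and variance_B: "\<And>s t. 0 \<le> t \<Longrightarrow> variance (\<lambda>\<omega>. B (t + s) \<omega> - B s \<omega>) = t"
    and increment_measurable_B:
      "\<And>s t. 0 \<le> t \<Longrightarrow> (\<lambda>\<omega>. B (t + s) \<omega> - B s \<omega>) \<in> borel_measurable (F (t + s))"
    and increment_indep_B: "\<And>s t. 0 \<le> t \<Longrightarrow>
      indep_set {(\<lambda>\<omega>. B (t + s) \<omega> - B s \<omega>) -` A \<inter> space M | A. A \<in> sets borel} (sets (F s))"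

section \<open>Properties of processes\<close>

definition adapted :: "(real \<Rightarrow> 'a measure) \<Rightarrow> (real \<Rightarrow> 'a \<Rightarrow> real) \<Rightarrow> bool" where
  "adapted F X \<longleftrightarrow> (\<forall>t. X t \<in> borel_measurable (F t))"

definition stationary :: "'a measure \<Rightarrow> (real \<Rightarrow> 'a \<Rightarrow> real) \<Rightarrow> bool" where
  "stationary M X \<longleftrightarrow> (\<forall>h J. finite J \<longrightarrow>
     distr M (Pi\<^sub>M J (\<lambda>_. borel)) (\<lambda>\<omega>. \<lambda>t\<in>J. X (t + h) \<omega>)
       = distr M (Pi\<^sub>M J (\<lambda>_. borel)) (\<lambda>\<omega>. \<lambda>t\<in>J. X t \<omega>))"

definition caglad :: "(real \<Rightarrow> real) \<Rightarrow> bool" where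
  "caglad x \<longleftrightarrow> (\<forall>t. continuous (at_left t) x \<and> (\<exists>l. (x \<longlongrightarrow> l) (at_right t)))"

section \<open>The Ito integral over the real line\<close>

text \<open>A simple process is \<open>\<Sum>i<n. \<xi> i * indicator {r i<..r (Suc i)}\<close> with bounded
  \<open>F (r i)\<close>-measurable \<open>\<xi> i\<close>. The integral is the \<open>L\<^sup>2\<close>-extension of the elementary
  integral of simple processes. As the integral is only determined up to null sets, it is a
  relation: \<open>has_ito_integral M F B H X\<close> says that \<open>X\<close> is a version of the integral of \<open>H\<close>
  against \<open>B\<close> over the whole line. Adaptedness (up to null sets) and square integrability of \<open>H\<close>
  follow from the approximation by simple processes.\<close>

definition simple_coeffs ::
  "'a measure \<Rightarrow> (real \<Rightarrow> 'a measure) \<Rightarrow> nat \<Rightarrow> (nat \<Rightarrow> real) \<Rightarrow> (nat \<Rightarrow> 'a \<Rightarrow> real) \<Rightarrow> bool" where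
  "simple_coeffs M F n r \<xi> \<longleftrightarrow> (\<forall>i<n. r i \<le> r (Suc i) \<and> \<xi> i \<in> borel_measurable (F (r i)) \<and>
     (\<exists>C. \<forall>\<omega>\<in>space M. \<bar>\<xi> i \<omega>\<bar> \<le> C))"

definition simple_process ::
  "nat \<Rightarrow> (nat \<Rightarrow> real) \<Rightarrow> (nat \<Rightarrow> 'a \<Rightarrow> real) \<Rightarrow> real \<Rightarrow> 'a \<Rightarrow> real" where
  "simple_process n r \<xi> s \<omega> = (\<Sum>i<n. \<xi> i \<omega> * indicator {r i<..r (Suc i)} s)"

definition simple_integral ::
  "(real \<Rightarrow> 'a \<Rightarrow> real) \<Rightarrow> nat \<Rightarrow> (nat \<Rightarrow> real) \<Rightarrow> (nat \<Rightarrow> 'a \<Rightarrow> real) \<Rightarrow> 'a \<Rightarrow> real" where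
  "simple_integral B n r \<xi> \<omega> = (\<Sum>i<n. \<xi> i \<omega> * (B (r (Suc i)) \<omega> - B (r i) \<omega>))"

definition has_ito_integral ::
  "'a measure \<Rightarrow> (real \<Rightarrow> 'a measure) \<Rightarrow> (real \<Rightarrow> 'a \<Rightarrow> real) \<Rightarrow> (real \<Rightarrow> 'a \<Rightarrow> real) \<Rightarrow>
    ('a \<Rightarrow> real) \<Rightarrow> bool" where
  "has_ito_integral M F B H X \<longleftrightarrow>
     (\<lambda>(s, \<omega>). H s \<omega>) \<in> borel_measurable (lborel \<Otimes>\<^sub>M M) \<and> X \<in> borel_measurable M \<and>
     (\<exists>n r \<xi>. (\<forall>k. simple_coeffs M F (n k) (r k) (\<xi> k)) \<and>
       (\<lambda>k. \<integral>\<^sup>+\<omega>. (\<integral>\<^sup>+s. ennreal ((simple_process (n k) (r k) (\<xi> k) s \<omega> - H s \<omega>)\<^sup>2) \<partial>lborel) \<partial>M)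
         \<longlonglongrightarrow> 0 \<and>
       (\<lambda>k. \<integral>\<^sup>+\<omega>. ennreal ((simple_integral B (n k) (r k) (\<xi> k) \<omega> - X \<omega>)\<^sup>2) \<partial>M) \<longlonglongrightarrow> 0)"

section \<open>The pathwise integral\<close>

text \<open>\<open>p n\<close> lists the points of the \<open>n\<close>-th partition of \<open>[0, T]\<close>, which has \<open>n\<close> intervals;
  \<open>p 0\<close> is irrelevant.\<close>

definition partition_sequence :: "real \<Rightarrow> (nat \<Rightarrow> nat \<Rightarrow> real) \<Rightarrow> bool" where
  "partition_sequence T p \<longleftrightarrow>
     (\<forall>n\<ge>1. p n 0 = 0 \<and> p n n = T \<and> (\<forall>i<n. p n i < p n (Suc i))) \<and>
     (\<lambda>n. MAX i\<in>{..<n}. \<bar>p n (Suc i) - p n i\<bar>) \<longlonglongrightarrow> 0"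

definition has_pathwise_integral ::
  "real \<Rightarrow> (real \<Rightarrow> real) \<Rightarrow> (real \<Rightarrow> real) \<Rightarrow> real \<Rightarrow> bool" where
  "has_pathwise_integral T z y I \<longleftrightarrow> (\<forall>p. partition_sequence T p \<longrightarrow>
     (\<lambda>n. \<Sum>i<n. z (p n i) * (y (p n (Suc i)) - y (p n i))) \<longlonglongrightarrow> I)"

text \<open>For \<open>T > 0\<close> partition sequences exist, so the integral, if it exists, is unique.\<close>

definition pathwise_integrable :: "real \<Rightarrow> (real \<Rightarrow> real) \<Rightarrow> (real \<Rightarrow> real) \<Rightarrow> bool" where
  "pathwise_integrable T z y \<longleftrightarrow> (\<exists>I. has_pathwise_integral T z y I)"

definition pathwise_integral :: "real \<Rightarrow> (real \<Rightarrow> real) \<Rightarrow> (real \<Rightarrow> real) \<Rightarrow> real" where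
  "pathwise_integral T z y = (THE I. has_pathwise_integral T z y I)"

end

theory Submission
  imports Defs
begin

text \<open>
  The formula follows from Taylor expansion once the \<open>(1 + \<beta>)\<close>-variation of \<open>Y\<close> along partitions
  of vanishing mesh tends to \<open>0\<close>: since \<open>f'\<close> is Hoelder continuous of order \<open>\<beta>\<close>, the Riemann sums
  differ from the telescoping sum \<open>f (Y T) - f (Y 0)\<close> by at most a constant times
  \<open>\<Sum>\<bar>Y t\<^sub>i\<^sub>+\<^sub>1 - Y t\<^sub>i\<bar> powr (1 + \<beta>)\<close> (\<open>pathwise_ito_formula\<close>). The null set may not depend on
  the partitions, so this has to be shown for all of them at once.

  Put \<open>H = \<alpha> + 1/2\<close>. As \<open>\<sigma>\<close> has only two moments, Kolmogorov's criterion would give Hoelder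
  continuity of order less than \<open>\<alpha>\<close> only. Variation is cheaper than Hoelder continuity: for
  \<open>p = min 2 (1 + \<beta>)\<close> one has \<open>H * p > 1\<close>, and second moments suffice. By chaining, a
  continuous path satisfies \<open>\<bar>y t - y s\<bar> powr p \<le> K * (\<Sum>n. q^n * V n s t)\<close> for every \<open>q > 1\<close>
  for which the series converges on \<open>[0, T]\<close>, where \<open>V n s t\<close> is the sum of the \<open>p\<close>-th powers of the increments over the dyadic intervals
  of level \<open>n\<close> contained in \<open>[s, t]\<close>. Now \<open>V n\<close> is superadditive in the interval and vanishes on
  intervals shorter than \<open>T / 2^n\<close>. Hence if \<open>(\<Sum>n. q^n * V n 0 T)\<close> converges, then its
  tails bound the \<open>p\<close>-variation along all fine partitions (\<open>power_variation_tendsto_0\<close>).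
  The expectation of this series is finite for some \<open>q > 1\<close> as soon as
  \<open>E\<bar>Y t - Y s\<bar> powr p \<le> D * (t - s) powr (H * p)\<close> (\<open>AE_summable_dyadic_var\<close>).

  The latter follows from \<open>E (Y t - Y s)\<^sup>2 \<le> C * (t - s) powr (2 * H)\<close>, because \<open>p \<le> 2\<close>.
  Up to a constant, the Ito isometry bounds the left-hand side by the squared \<open>L\<^sup>2\<close>-norm of the increment of the
  kernel \<open>g x = L x * x powr \<alpha>\<close>, times the supremum of the second moments of \<open>\<sigma>\<close>
  (\<open>moving_average_increment_second_moment\<close>), and this norm is estimated from
  \<open>\<bar>g x\<bar> \<le> K * x powr \<alpha>\<close> and \<open>\<bar>g' x\<bar> \<le> K * x powr (\<alpha> - 1)\<close>, valid for all \<open>x > 0\<close>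
  (\<open>kernel_L2_increment\<close>).
\<close>

section \<open>Variation of a path and its dyadic increments\<close>

text \<open>The sum of the \<open>p\<close>-th powers of the increments of \<open>y\<close> over those intervals of the \<open>n\<close>-th
  dyadic subdivision of \<open>[0, T]\<close> that are contained in \<open>[s, t]\<close>.\<close>

definition dyadic_var :: "real \<Rightarrow> real \<Rightarrow> (real \<Rightarrow> real) \<Rightarrow> nat \<Rightarrow> real \<Rightarrow> real \<Rightarrow> real" where
  "dyadic_var T p y n s t =
     (\<Sum>k | k < 2^n \<and> s \<le> real k * T / 2^n \<and> real (Suc k) * T / 2^n \<le> t.
        \<bar>y (real (Suc k) * T / 2^n) - y (real k * T / 2^n)\<bar> powr p)"

lemma dyadic_var_nonneg: "0 \<le> dyadic_var T p y n s t"
  unfolding dyadic_var_def by (intro sum_nonneg) auto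

lemma dyadic_var_mono:
  assumes "s' \<le> s" "t \<le> t'"
  shows "dyadic_var T p y n s t \<le> dyadic_var T p y n s' t'"
  unfolding dyadic_var_def using assms by (intro sum_mono2) auto

lemma dyadic_var_superadditive:
  assumes "0 < T" "s \<le> u" "u \<le> t"
  shows "dyadic_var T p y n s u + dyadic_var T p y n u t \<le> dyadic_var T p y n s t"
proof -
  let ?D = "\<lambda>s t. {k::nat. k < 2^n \<and> s \<le> real k * T / 2^n \<and> real (Suc k) * T / 2^n \<le> t}"
  have lt: "real k * T / 2^n < real (Suc k) * T / 2^n" for k
    using assms(1) by (simp add: field_simps)
  have "?D s u \<inter> ?D u t = {}"
    using lt by (auto simp: not_le dest: order.trans) (meson leD order.trans)
  then show ?thesis
    unfolding dyadic_var_def using assms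
    by (subst sum.union_disjoint[symmetric]) (auto intro!: sum_mono2 simp del: of_nat_Suc
        intro: order.trans[OF less_imp_le[OF lt]] order.trans[OF _ less_imp_le[OF lt]])
qed

lemma mono_upto_if_steps:
  fixes x :: "nat \<Rightarrow> real"
  assumes "\<And>i. i < m \<Longrightarrow> x i \<le> x (Suc i)" "i \<le> j" "j \<le> m"
  shows "x i \<le> x j"
  using assms(2,3)
proof (induction rule: dec_induct)
  case (step n)
  then show ?case using assms(1)[of n] by simp
qed simp

lemma dyadic_var_sum_le:
  assumes "0 < T" "\<And>i. i < m \<Longrightarrow> x i \<le> x (Suc i)"
  shows "(\<Sum>i<m. dyadic_var T p y n (x i) (x (Suc i))) \<le> dyadic_var T p y n (x 0) (x m)"
  using assms(2)
proof (induction m)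
  case 0
  then show ?case by (simp add: dyadic_var_nonneg)
next
  case (Suc m)
  have "x 0 \<le> x m"
    by (rule mono_upto_if_steps[of "Suc m"]) (use Suc.prems in auto)
  then show ?case using Suc dyadic_var_superadditive[OF assms(1), of "x 0" "x m" "x (Suc m)" p y n]
    by force
qed

lemma dyadic_var_eq_0:
  assumes "t - s < T / 2^n"
  shows "dyadic_var T p y n s t = 0"
proof -
  have "{k::nat. k < 2^n \<and> s \<le> real k * T / 2^n \<and> real (Suc k) * T / 2^n \<le> t} = {}"
    using assms by (auto simp: field_simps)
  then show ?thesis unfolding dyadic_var_def by (simp only: sum.empty)
qed

lemma dyadic_increment_le:
  assumes "0 < p" "k < 2^n" "s \<le> real k * T / 2^n" "real (Suc k) * T / 2^n \<le> t"
  shows "\<bar>y (real (Suc k) * T / 2^n) - y (real k * T / 2^n)\<bar> \<le> dyadic_var T p y n s t powr (1/p)"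
proof -
  let ?d = "\<lambda>k. \<bar>y (real (Suc k) * T / 2^n) - y (real k * T / 2^n)\<bar>"
  have "?d k powr p \<le> dyadic_var T p y n s t"
    unfolding dyadic_var_def using assms by (intro member_le_sum) auto
  then have "(?d k powr p) powr (1/p) \<le> dyadic_var T p y n s t powr (1/p)"
    using assms by (intro powr_mono2) auto
  then show ?thesis using assms(1) by (simp add: powr_powr)
qed

text \<open>Between two dyadic points of level \<open>N\<close>, each level contributes at most two increments: rounding
  the endpoints inwards to level \<open>N - 1\<close> costs at most one interval of level \<open>N\<close> at either end.\<close>

lemma dyadic_chaining:
  assumes "0 < T" "0 < p" "a \<le> b" "b \<le> 2^N"
  shows "\<bar>y (real b * T / 2^N) - y (real a * T / 2^N)\<bar>
    \<le> 2 * (\<Sum>n\<le>N. dyadic_var T p y n (real a * T / 2^N) (real b * T / 2^N) powr (1/p))"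
  using assms(3,4)
proof (induction N arbitrary: a b)
  case 0
  show ?case
  proof (cases "a = b")
    case False
    then have ab: "a = 0" "b = Suc 0" using 0 by auto
    show ?thesis
      using dyadic_increment_le[OF assms(2), of 0 0 0 T T y] dyadic_var_nonneg[of T p y 0 0 T]
      by (simp add: ab)
  qed (auto intro!: sum_nonneg)
next
  case (Suc N)
  show ?case
  proof (cases "a = b")
    case False
    let ?s = "real a * T / 2^Suc N" and ?t = "real b * T / 2^Suc N"
    \<comment> \<open>the endpoints rounded inwards to level \<open>N\<close>; \<open>a < b\<close> ensures \<open>a' \<le> b'\<close>\<close>
    define a' b' where "a' = (a + 1) div 2" and "b' = b div 2"
    have le: "a' \<le> b'" "b' \<le> 2^N" using Suc.prems False by (auto simp: a'_def b'_def)
    have s': "real a' * T / 2^N = real (2 * a') * T / 2^Suc N"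
      and t': "real b' * T / 2^N = real (2 * b') * T / 2^Suc N" by simp_all
    let ?s' = "real a' * T / 2^N" and ?t' = "real b' * T / 2^N"
    have ss': "?s \<le> ?s'" unfolding s' using assms(1)
      by (intro divide_right_mono mult_right_mono) (auto simp: a'_def)
    have tt': "?t' \<le> ?t" unfolding t' using assms(1)
      by (intro divide_right_mono mult_right_mono) (auto simp: b'_def)
    have st': "?s' \<le> ?t'" using assms(1) le by (intro divide_right_mono mult_right_mono) auto
    let ?V = "\<lambda>n. dyadic_var T p y n ?s ?t powr (1/p)"
    have 1: "\<bar>y ?s' - y ?s\<bar> \<le> ?V (Suc N)"
    proof (cases "even a")
      case False
      then have e: "2 * a' = Suc a" by (auto simp: a'_def elim!: oddE)
      show ?thesis
        using dyadic_increment_le[OF assms(2), of a "Suc N" ?s T ?t y] Suc.prems \<open>a \<noteq> b\<close>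
          st' tt' unfolding s' e by auto
    qed (auto simp: a'_def elim!: evenE)
    have 2: "\<bar>y ?t - y ?t'\<bar> \<le> ?V (Suc N)"
    proof (cases "even b")
      case False
      then have e: "b = Suc (2 * b')" by (auto simp: b'_def elim!: oddE)
      have "real (Suc (2 * b')) * T / 2^Suc N = ?t" using e by simp
      then show ?thesis
        using dyadic_increment_le[OF assms(2), of "2 * b'" "Suc N" ?s T ?t y] Suc.prems
          st' ss' e unfolding t' by auto
    qed (auto simp: b'_def elim!: evenE)
    have "\<bar>y ?t' - y ?s'\<bar> \<le> 2 * (\<Sum>n\<le>N. dyadic_var T p y n ?s' ?t' powr (1/p))"
      using Suc.IH le by blast
    also have "\<dots> \<le> 2 * (\<Sum>n\<le>N. ?V n)"
      using ss' tt' assms(2)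
      by (intro mult_left_mono sum_mono powr_mono2 dyadic_var_mono dyadic_var_nonneg) auto
    finally show ?thesis using 1 2 by simp
  next
    case True
    then show ?thesis by (simp del: sum.atMost_Suc add: sum_nonneg)
  qed
qed

text \<open>Chaining, with Hoelder's inequality replaced by the cruder bound of each term by the whole series:
  \<open>V n powr (1/p)\<close> is at most \<open>S powr (1/p)\<close> times the geometric weight \<open>(q powr (-1/p))^n\<close>, where
  \<open>S\<close> is the series on the right-hand side. General endpoints are limits of dyadic points inside
  \<open>[s, t]\<close>.\<close>

lemma powr_increment_le_weighted_dyadic_var:
  fixes p q :: real
  assumes "0 < T" "0 < p" "1 < q" and cont: "continuous_on {0..T} y"
    and sum: "summable (\<lambda>n. q^n * dyadic_var T p y n 0 T)"
    and st: "0 \<le> s" "s \<le> t" "t \<le> T"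
  shows "\<bar>y t - y s\<bar> powr p
    \<le> (2 / (1 - q powr (-1/p))) powr p * (\<Sum>n. q^n * dyadic_var T p y n s t)"
proof (cases "s = t")
  case True
  have "summable (\<lambda>n. q^n * dyadic_var T p y n s t)"
    using assms dyadic_var_nonneg
    by (intro summable_comparison_test'[OF sum, of 0])
       (auto simp: abs_mult intro!: mult_left_mono dyadic_var_mono)
  then show ?thesis using True assms
    by (auto intro!: mult_nonneg_nonneg suminf_nonneg dyadic_var_nonneg)
next
  case False
  let ?V = "\<lambda>n. dyadic_var T p y n s t"
  define r where "r = q powr (-1/p)"
  have r: "0 < r" "r < 1" using assms by (auto simp: r_def powr_less_one)
  have sumV: "summable (\<lambda>n. q^n * ?V n)"
    using assms dyadic_var_nonneg
    by (intro summable_comparison_test'[OF sum, of 0])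
       (auto simp: abs_mult intro!: mult_left_mono dyadic_var_mono)
  define S where "S = (\<Sum>n. q^n * ?V n)"
  have S0: "0 \<le> S" unfolding S_def using assms(3)
    by (intro suminf_nonneg sumV mult_nonneg_nonneg dyadic_var_nonneg) auto
  have V: "?V n powr (1/p) \<le> S powr (1/p) * r^n" for n
  proof -
    have "q^n * ?V n \<le> S"
    proof -
      have "(\<Sum>i\<in>{n}. q^i * ?V i) \<le> S"
        unfolding S_def using assms(3) by (intro sum_le_suminf sumV) (auto simp: dyadic_var_nonneg)
      then show ?thesis by simp
    qed
    then have "?V n \<le> S / q^n" using assms(3) by (simp add: field_simps)
    then have "?V n powr (1/p) \<le> (S / q^n) powr (1/p)"
      using assms(2) by (intro powr_mono2 dyadic_var_nonneg) auto
    also have "\<dots> = S powr (1/p) * r^n"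
    proof -
      have "(S / q^n) powr (1/p) = S powr (1/p) * (q powr real n) powr (-(1/p))"
        using assms(3) S0 by (simp add: powr_divide powr_realpow powr_minus_divide)
      also have "(q powr real n) powr (-(1/p)) = r powr real n"
        unfolding r_def powr_powr by (simp add: mult.commute)
      also have "\<dots> = r^n" using r by (simp add: powr_realpow)
      finally show ?thesis .
    qed
    finally show ?thesis .
  qed
  have bound: "2 * (\<Sum>n\<le>N. ?V n powr (1/p)) \<le> 2 / (1 - r) * S powr (1/p)" for N
  proof -
    have "(\<Sum>n\<le>N. ?V n powr (1/p)) \<le> S powr (1/p) * (\<Sum>n\<le>N. r^n)"
      unfolding sum_distrib_left by (intro sum_mono V)
    also have "(\<Sum>n\<le>N. r^n) \<le> 1 / (1 - r)"
      using sum_le_suminf[of "\<lambda>n. r^n" "{..N}"] r by (simp add: suminf_geometric)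
    finally have "(\<Sum>n\<le>N. ?V n powr (1/p)) \<le> S powr (1/p) * (1 / (1 - r))"
      by (simp add: mult_left_mono)
    then show ?thesis by (simp add: mult.commute)
  qed
  define a b where "a N = nat \<lceil>s * 2^N / T\<rceil>" and "b N = nat \<lfloor>t * 2^N / T\<rfloor>" for N :: nat
  let ?a = "\<lambda>N. real (a N) * T / 2^N" and ?b = "\<lambda>N. real (b N) * T / 2^N"
  have a: "s \<le> ?a N" "?a N \<le> s + T / 2^N" for N
  proof -
    have "s * 2^N / T \<le> real (a N)" "real (a N) \<le> s * 2^N / T + 1"
      using st assms(1) by (auto simp: a_def)
    then show "s \<le> ?a N" "?a N \<le> s + T / 2^N" using assms(1) by (auto simp: field_simps)
  qed
  have b: "?b N \<le> t" "t - T / 2^N \<le> ?b N" for N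
  proof -
    have "real (b N) \<le> t * 2^N / T" "t * 2^N / T - 1 \<le> real (b N)"
      using st assms(1) by (auto simp: b_def)
    then have "real (b N) * (T / 2^N) \<le> t * 2^N / T * (T / 2^N)"
        "(t * 2^N / T - 1) * (T / 2^N) \<le> real (b N) * (T / 2^N)"
      using assms(1) by (auto intro!: mult_right_mono simp del: times_divide_eq_right times_divide_eq_left)
    moreover have "t * 2^N / T * (T / 2^N) = t" "(t * 2^N / T - 1) * (T / 2^N) = t - T / 2^N"
      using assms(1) by (simp_all add: field_simps)
    ultimately show "?b N \<le> t" "t - T / 2^N \<le> ?b N" by (simp_all only: times_divide_eq_right)
  qed
  have T0: "(\<lambda>N. T / 2^N) \<longlonglongrightarrow> 0" 
  proof -
    have "(\<lambda>N. T * (1/2)^N) \<longlonglongrightarrow> T * 0"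
      by (intro tendsto_mult tendsto_const LIMSEQ_power_zero) simp
    then show ?thesis by (simp add: power_divide)
  qed
  have alim: "?a \<longlonglongrightarrow> s"
    using tendsto_add[OF tendsto_const[of s] T0] a
    by (intro tendsto_sandwich[of "\<lambda>_. s" ?a _ "\<lambda>N. s + T / 2^N"]) auto
  have blim: "?b \<longlonglongrightarrow> t"
    using tendsto_diff[OF tendsto_const[of t] T0] b
    by (intro tendsto_sandwich[of "\<lambda>N. t - T / 2^N" ?b _ "\<lambda>_. t"]) auto
  have ev: "\<forall>\<^sub>F N in sequentially. ?a N < ?b N"
    using order_tendstoD(1)[OF tendsto_diff[OF blim alim], of 0] st False by simp
  have ab: "\<bar>y (?b N) - y (?a N)\<bar> \<le> 2 / (1 - r) * S powr (1/p)" if "?a N < ?b N" for N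
  proof -
    have "a N \<le> b N" using that assms(1) by (simp add: divide_less_cancel)
    moreover have "b N \<le> 2^N"
    proof -
      have "real (b N) * T \<le> T * 2^N" using order.trans[OF b(1)[of N] st(3)]
        by (simp add: field_simps)
      then have "real (b N) \<le> 2^N" using assms(1) by (simp add: mult.commute)
      then show ?thesis by (metis of_nat_le_iff of_nat_numeral of_nat_power)
    qed
    ultimately have "\<bar>y (?b N) - y (?a N)\<bar>
        \<le> 2 * (\<Sum>n\<le>N. dyadic_var T p y n (?a N) (?b N) powr (1/p))"
      by (intro dyadic_chaining assms)
    also have "\<dots> \<le> 2 * (\<Sum>n\<le>N. ?V n powr (1/p))"
      using a b assms(2)
      by (intro mult_left_mono sum_mono powr_mono2 dyadic_var_mono dyadic_var_nonneg) auto
    finally show ?thesis using bound[of N] by simp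
  qed
  have ylim: "(\<lambda>N. y (c N)) \<longlonglongrightarrow> y l"
    if "c \<longlonglongrightarrow> l" "l \<in> {0..T}" "\<forall>\<^sub>F N in sequentially. c N \<in> {0..T}" for c l
    using cont that by (rule continuous_on_tendsto_compose)
  have "(\<lambda>N. \<bar>y (?b N) - y (?a N)\<bar>) \<longlonglongrightarrow> \<bar>y t - y s\<bar>"
  proof (intro tendsto_rabs tendsto_diff ylim alim blim)
    show "\<forall>\<^sub>F N in sequentially. ?b N \<in> {0..T}"
      using ev
    proof eventually_elim
      case (elim N)
      then show ?case using a(1)[of N] b(1)[of N] st by (auto simp del: times_divide_eq_left)
    qed
    show "\<forall>\<^sub>F N in sequentially. ?a N \<in> {0..T}"
      using ev
    proof eventually_elim
      case (elim N)
      then show ?case using a(1)[of N] b(1)[of N] st by (auto simp del: times_divide_eq_left)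
    qed
  qed (use st in auto)
  then have "\<bar>y t - y s\<bar> \<le> 2 / (1 - r) * S powr (1/p)"
    by (rule tendsto_upperbound[OF _ eventually_mono[OF ev ab]]) auto
  then have "\<bar>y t - y s\<bar> powr p \<le> (2 / (1 - r) * S powr (1/p)) powr p"
    using assms(2) by (intro powr_mono2) auto
  also have "\<dots> = (2 / (1 - r)) powr p * S"
    using r S0 assms(2) by (subst powr_mult) (simp_all add: powr_powr)
  finally show ?thesis by (simp add: r_def S_def)
qed

text \<open>The convergence holds for every partition sequence, under one condition on the path that does not
  involve the partitions.\<close>

lemma power_variation_tendsto_0:
  fixes p q :: real
  assumes "0 < T" "0 < p" "1 < q" and cont: "continuous_on {0..T} y"
    and sum: "summable (\<lambda>n. q^n * dyadic_var T p y n 0 T)"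
    and part: "partition_sequence T \<pi>"
  shows "(\<lambda>n. \<Sum>i<n. \<bar>y (\<pi> n (Suc i)) - y (\<pi> n i)\<bar> powr p) \<longlonglongrightarrow> 0"
proof (rule LIMSEQ_I)
  fix e :: real assume e: "0 < e"
  define K where "K = (2 / (1 - q powr (-1/p))) powr p"
  have K: "0 < K" using assms by (auto simp: K_def powr_less_one)
  let ?V = "\<lambda>n. dyadic_var T p y n"
  obtain N where N: "norm (\<Sum>n. q^(n+N) * ?V (n+N) 0 T) < e / K"
    using suminf_exist_split[OF _ sum, of "e / K"] e K by auto
  have nn: "0 \<le> q^n * ?V n s t" for n s t using assms(3) by (simp add: dyadic_var_nonneg)
  have sumV: "summable (\<lambda>n. q^n * ?V n s t)" if "0 \<le> s" "t \<le> T" for s t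
    using that assms(3) dyadic_var_nonneg
    by (intro summable_comparison_test'[OF sum, of 0])
       (auto simp: abs_mult intro!: mult_left_mono dyadic_var_mono)
  have "\<forall>\<^sub>F m in sequentially. (MAX i\<in>{..<m}. \<bar>\<pi> m (Suc i) - \<pi> m i\<bar>) < T / 2^N"
    using part assms(1) unfolding partition_sequence_def by (intro order_tendstoD) auto
  then obtain m0 where m0: "\<And>m. m \<ge> m0 \<Longrightarrow> (MAX i\<in>{..<m}. \<bar>\<pi> m (Suc i) - \<pi> m i\<bar>) < T / 2^N"
    unfolding eventually_sequentially by blast
  show "\<exists>no. \<forall>m\<ge>no. norm ((\<Sum>i<m. \<bar>y (\<pi> m (Suc i)) - y (\<pi> m i)\<bar> powr p) - 0) < e"
  proof (intro exI allI impI)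
    fix m assume m: "max 1 m0 \<le> m"
    let ?x = "\<pi> m"
    have x: "?x 0 = 0" "?x m = T" "\<And>i. i < m \<Longrightarrow> ?x i < ?x (Suc i)"
      using part m unfolding partition_sequence_def by auto
    have x0: "0 \<le> ?x i" and xT: "?x i \<le> T" if "i \<le> m" for i
      using mono_upto_if_steps[of m ?x 0 i] mono_upto_if_steps[of m ?x i m] that x
      by (auto simp: less_imp_le)
    have mesh: "?x (Suc i) - ?x i < T / 2^N" if "i < m" for i
    proof -
      have "\<bar>?x (Suc i) - ?x i\<bar> \<le> (MAX i\<in>{..<m}. \<bar>?x (Suc i) - ?x i\<bar>)"
        using that by (intro Max_ge) auto
      then show ?thesis using m0[of m] m by auto
    qed
    have "(\<Sum>i<m. \<bar>y (?x (Suc i)) - y (?x i)\<bar> powr p)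
        \<le> (\<Sum>i<m. K * (\<Sum>n. q^n * ?V n (?x i) (?x (Suc i))))"
      unfolding K_def
      by (intro sum_mono powr_increment_le_weighted_dyadic_var assms x0 xT less_imp_le[OF x(3)]) auto
    also have "\<dots> = K * (\<Sum>n. \<Sum>i<m. q^n * ?V n (?x i) (?x (Suc i)))"
      by (subst suminf_sum) (auto simp: sum_distrib_left intro!: sumV x0 xT)
    also have "(\<Sum>n. \<Sum>i<m. q^n * ?V n (?x i) (?x (Suc i)))
        = (\<Sum>n. \<Sum>i<m. q^(n+N) * ?V (n+N) (?x i) (?x (Suc i)))"
    proof -
      \<comment> \<open>dyadic intervals of level below \<open>N\<close> are longer than the mesh\<close>
      have "?V n (?x i) (?x (Suc i)) = 0" if "n < N" "i < m" for n i
      proof (rule dyadic_var_eq_0)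
        have "T / 2^N \<le> T / 2^n" using that assms(1)
          by (intro divide_left_mono) auto
        then show "?x (Suc i) - ?x i < T / 2^n" using mesh[OF that(2)] by simp
      qed
      then have "(\<Sum>n<N. \<Sum>i<m. q^n * ?V n (?x i) (?x (Suc i))) = 0" by simp
      moreover have "summable (\<lambda>n. \<Sum>i<m. q^n * ?V n (?x i) (?x (Suc i)))"
        by (intro summable_sum sumV x0 xT) auto
      ultimately show ?thesis by (subst suminf_split_initial_segment[where k=N]) auto
    qed
    also have "\<dots> \<le> (\<Sum>n. q^(n+N) * ?V (n+N) 0 T)"
    proof (rule suminf_le)
      fix n
      have "(\<Sum>i<m. ?V (n+N) (?x i) (?x (Suc i))) \<le> ?V (n+N) (?x 0) (?x m)"
        using x by (intro dyadic_var_sum_le assms less_imp_le) auto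
      then show "(\<Sum>i<m. q^(n+N) * ?V (n+N) (?x i) (?x (Suc i))) \<le> q^(n+N) * ?V (n+N) 0 T"
        using assms(3) x by (simp add: sum_distrib_left[symmetric])
      show "summable (\<lambda>n. \<Sum>i<m. q^(n+N) * ?V (n+N) (?x i) (?x (Suc i)))"
        by (intro summable_sum summable_ignore_initial_segment[OF sumV] x0 xT) auto
      show "summable (\<lambda>n. q^(n+N) * ?V (n+N) 0 T)"
        by (intro summable_ignore_initial_segment[OF sum])
    qed
    also have "\<dots> < e / K" using N by simp
    finally have "(\<Sum>i<m. \<bar>y (?x (Suc i)) - y (?x i)\<bar> powr p) < e"
      using K by (simp add: field_simps)
    then show "norm ((\<Sum>i<m. \<bar>y (?x (Suc i)) - y (?x i)\<bar> powr p) - 0) < e"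
      by (simp add: sum_nonneg)
  qed
qed

section \<open>The pathwise Ito formula\<close>

lemma Holder_derivative_remainder:
  fixes f f' :: "real \<Rightarrow> real"
  assumes "\<And>x. (f has_real_derivative f' x) (at x)" "0 \<le> \<beta>" "0 \<le> C"
    and "\<And>x y. \<bar>f' x - f' y\<bar> \<le> C * \<bar>x - y\<bar> powr \<beta>"
  shows "\<bar>f b - f a - f' a * (b - a)\<bar> \<le> C * \<bar>b - a\<bar> powr (1 + \<beta>)"
proof (cases "a = b")
  case False
  obtain z where z: "\<bar>z - a\<bar> \<le> \<bar>b - a\<bar>" "f b - f a = (b - a) * f' z"
  proof (cases "a < b")
    case True
    show ?thesis using MVT2[OF True, of f f'] assms(1) that by force
  next
    case F: False
    then have "b < a" using False by simp
    from MVT2[OF this, of f f'] assms(1) obtain z where "b < z" "z < a" "f a - f b = (a - b) * f' z"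
      by blast
    then show ?thesis using that[of z] by (simp add: algebra_simps)
  qed
  have "\<bar>f b - f a - f' a * (b - a)\<bar> = \<bar>b - a\<bar> * \<bar>f' z - f' a\<bar>"
    unfolding z(2) by (simp add: abs_mult[symmetric] algebra_simps)
  also have "\<dots> \<le> \<bar>b - a\<bar> * (C * \<bar>b - a\<bar> powr \<beta>)"
    using z(1) assms(2,3)
    by (intro mult_left_mono order.trans[OF assms(4)] powr_mono2) auto
  also have "\<dots> = C * \<bar>b - a\<bar> powr (1 + \<beta>)"
    using False by (simp add: powr_add)
  finally show ?thesis .
qed simp

lemma ex_partition_sequence:
  assumes "0 < T"
  shows "\<exists>\<pi>. partition_sequence T \<pi>"
proof -
  define \<pi> where "\<pi> n i = real i * T / real n" for n i :: nat
  have "(MAX i\<in>{..<n}. \<bar>\<pi> n (Suc i) - \<pi> n i\<bar>) = T / real n" if "n \<ge> 1" for n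
  proof -
    have "\<bar>\<pi> n (Suc i) - \<pi> n i\<bar> = T / real n" for i
      using assms by (simp add: \<pi>_def diff_divide_distrib[symmetric] algebra_simps)
    moreover have "{..<n} \<noteq> {}" using that by (simp add: lessThan_empty_iff)
    ultimately show ?thesis by simp
  qed
  then have "\<forall>\<^sub>F n in sequentially. T / real n = (MAX i\<in>{..<n}. \<bar>\<pi> n (Suc i) - \<pi> n i\<bar>)"
    by (intro eventually_sequentiallyI[of 1]) (rule sym)
  moreover have "(\<lambda>n. T / real n) \<longlonglongrightarrow> 0" by (rule lim_const_over_n)
  ultimately have "(\<lambda>n. MAX i\<in>{..<n}. \<bar>\<pi> n (Suc i) - \<pi> n i\<bar>) \<longlonglongrightarrow> 0"
    by (rule Lim_transform_eventually[rotated])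
  then show ?thesis using assms
    by (intro exI[of _ \<pi>]) (auto simp: partition_sequence_def \<pi>_def divide_strict_right_mono)
qed

lemma pathwise_integral_eqI:
  assumes "0 < T" "has_pathwise_integral T z y I"
  shows "pathwise_integral T z y = I"
  unfolding pathwise_integral_def
proof (rule the_equality)
  fix J assume "has_pathwise_integral T z y J"
  moreover obtain \<pi> where "partition_sequence T \<pi>" using ex_partition_sequence[OF assms(1)] ..
  ultimately show "J = I"
    using assms(2) LIMSEQ_unique unfolding has_pathwise_integral_def by blast
qed (rule assms(2))

lemma pathwise_ito_formula:
  fixes f f' :: "real \<Rightarrow> real" and p q :: real
  assumes "0 < T" "0 < p" "p \<le> 1 + \<beta>" "1 < q" "0 \<le> \<beta>"
    and cont: "continuous_on {0..T} y"
    and sum: "summable (\<lambda>n. q^n * dyadic_var T p y n 0 T)"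
    and f: "\<And>x. (f has_real_derivative f' x) (at x)"
    and C: "\<And>x y. \<bar>f' x - f' y\<bar> \<le> C * \<bar>x - y\<bar> powr \<beta>"
  shows "has_pathwise_integral T (\<lambda>s. f' (y s)) y (f (y T) - f (y 0))"
  unfolding has_pathwise_integral_def
proof (intro allI impI)
  fix \<pi> assume part: "partition_sequence T \<pi>"
  let ?D = "\<lambda>n i. y (\<pi> n (Suc i)) - y (\<pi> n i)"
  let ?P = "\<lambda>n. \<Sum>i<n. \<bar>?D n i\<bar> powr p"
  let ?I = "\<lambda>n. \<Sum>i<n. f' (y (\<pi> n i)) * ?D n i"
  have C0: "0 \<le> C" using C[of 0 1] by (simp add: order.trans[OF abs_ge_zero])
  have P: "?P \<longlonglongrightarrow> 0" by (rule power_variation_tendsto_0) (use assms part in auto)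
  have small: "\<forall>\<^sub>F n in sequentially. ?P n < 1" using P by (intro order_tendstoD) auto
  have "(\<lambda>n. f (y T) - f (y 0) - ?I n) \<longlonglongrightarrow> 0"
  proof (rule Lim_null_comparison)
    show "\<forall>\<^sub>F n in sequentially. norm (f (y T) - f (y 0) - ?I n) \<le> C * ?P n"
      using small eventually_ge_at_top[of 1]
    proof eventually_elim
      case (elim n)
      have "f (y T) - f (y 0) = (\<Sum>i<n. f (y (\<pi> n (Suc i))) - f (y (\<pi> n i)))"
        using part elim(2) sum_lessThan_telescope[of "\<lambda>i. f (y (\<pi> n i))" n]
        by (simp add: partition_sequence_def)
      then have "norm (f (y T) - f (y 0) - ?I n)
          \<le> (\<Sum>i<n. \<bar>f (y (\<pi> n (Suc i))) - f (y (\<pi> n i)) - f' (y (\<pi> n i)) * ?D n i\<bar>)"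
        by (simp add: sum_subtractf[symmetric])
      also have "\<dots> \<le> (\<Sum>i<n. C * \<bar>?D n i\<bar> powr p)"
      proof (rule sum_mono)
        fix i assume i: "i \<in> {..<n}"
        \<comment> \<open>increments are eventually at most \<open>1\<close>, so that \<open>p\<close> may be smaller than \<open>1 + \<beta>\<close>\<close>
        have "\<bar>?D n i\<bar> powr p \<le> ?P n" using i by (intro member_le_sum) auto
        then have "\<bar>?D n i\<bar> powr p < 1" using elim(1) by simp
        then have "\<bar>?D n i\<bar> \<le> 1"
          using ge_one_powr_ge_zero[of "\<bar>?D n i\<bar>" p] assms(2) by linarith
        then have "\<bar>?D n i\<bar> powr (1 + \<beta>) \<le> \<bar>?D n i\<bar> powr p"
          using assms by (intro powr_mono') auto
        then show "\<bar>f (y (\<pi> n (Suc i))) - f (y (\<pi> n i)) - f' (y (\<pi> n i)) * ?D n i\<bar>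
            \<le> C * \<bar>?D n i\<bar> powr p"
          using Holder_derivative_remainder[OF f assms(5) C0 C, of "y (\<pi> n (Suc i))" "y (\<pi> n i)"] C0
          by (meson mult_left_mono order.trans)
      qed
      finally show ?case by (simp add: sum_distrib_left)
    qed
    show "(\<lambda>n. C * ?P n) \<longlonglongrightarrow> 0" using tendsto_mult_right_zero[OF P] .
  qed
  then have "(\<lambda>n. (f (y T) - f (y 0)) - (f (y T) - f (y 0) - ?I n)) \<longlonglongrightarrow> f (y T) - f (y 0) - 0"
    by (intro tendsto_diff tendsto_const)
  then show "?I \<longlonglongrightarrow> f (y T) - f (y 0)" by simp
qed

section \<open>The Ito isometry\<close>

context two_sided_brownian_motion
begin

lemma F_measurable_imp_measurable:
  "X \<in> borel_measurable (F t) \<Longrightarrow> X \<in> borel_measurable M" for X :: "'a \<Rightarrow> real"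
  by (rule borel_measurable_subalgebra[OF sets_F_subset space_F])

lemma F_measurable_mono:
  "X \<in> borel_measurable (F s) \<Longrightarrow> s \<le> t \<Longrightarrow> X \<in> borel_measurable (F t)" for X :: "'a \<Rightarrow> real"
  by (rule borel_measurable_subalgebra[OF sets_F_mono]) (simp_all only: space_F)

lemma increment_F_measurable:
  "s \<le> t \<Longrightarrow> (\<lambda>\<omega>. B t \<omega> - B s \<omega>) \<in> borel_measurable (F t)"
  using increment_measurable_B[of "t - s" s] by simp

lemma increment_measurable [measurable]: "(\<lambda>\<omega>. B t \<omega> - B s \<omega>) \<in> borel_measurable M"
proof (cases "s \<le> t")
  case False
  then have "(\<lambda>\<omega>. - (B s \<omega> - B t \<omega>)) \<in> borel_measurable M"
    by (intro borel_measurable_uminus F_measurable_imp_measurable[OF increment_F_measurable]) simp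
  then show ?thesis by simp
qed (rule F_measurable_imp_measurable[OF increment_F_measurable])

text \<open>Integrability of the increments is read off from their nonzero variance, since the Bochner integral
  of a non-integrable function is \<open>0\<close>.\<close>

lemma increment_integrable: "integrable M (\<lambda>\<omega>. B t \<omega> - B s \<omega>)"
proof -
  have *: "integrable M (\<lambda>\<omega>. B t \<omega> - B s \<omega>)" if "s < t" for s t
  proof -
    let ?m = "expectation (\<lambda>\<omega>. B t \<omega> - B s \<omega>)"
    have "integrable M (\<lambda>\<omega>. (B t \<omega> - B s \<omega> - ?m)\<^sup>2)"
    proof (rule ccontr)
      assume "\<not> ?thesis"
      from not_integrable_integral_eq[OF this] variance_B[of "t - s" s] that show False by simp
    qed
    then have "integrable M (\<lambda>\<omega>. B t \<omega> - B s \<omega> - ?m)"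
      by (rule square_integrable_imp_integrable[rotated])
         (intro borel_measurable_diff increment_measurable borel_measurable_const)
    from Bochner_Integration.integrable_add[OF this integrable_const[of ?m]] show ?thesis by simp
  qed
  show ?thesis
  proof (cases s t rule: linorder_cases)
    case greater
    from Bochner_Integration.integrable_minus[OF *[OF this]] show ?thesis by simp
  next
    case equal
    then show ?thesis by simp
  qed (rule *)
qed

lemma increment_mean: "expectation (\<lambda>\<omega>. B t \<omega> - B s \<omega>) = 0"
proof -
  have B: "integrable M (B t)" for t
    using increment_integrable[of t 0]
    by (subst Bochner_Integration.integrable_cong[OF refl, of M _ "\<lambda>\<omega>. B t \<omega> - B 0 \<omega>"])
       (auto simp: B_0)
  show ?thesis using Bochner_Integration.integral_diff[OF B[of t] B[of s]] by (simp add: centered_B)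
qed

lemma increment_second_moment:
  "s \<le> t \<Longrightarrow> expectation (\<lambda>\<omega>. (B t \<omega> - B s \<omega>)\<^sup>2) = t - s"
  using variance_B[of "t - s" s] by (simp add: increment_mean)

lemma increment_square_integrable: "integrable M (\<lambda>\<omega>. (B t \<omega> - B s \<omega>)\<^sup>2)"
proof -
  have *: "integrable M (\<lambda>\<omega>. (B t \<omega> - B s \<omega>)\<^sup>2)" if "s < t" for s t
    using increment_second_moment[of s t] that not_integrable_integral_eq by fastforce
  show ?thesis
  proof (cases s t rule: linorder_cases)
    case greater
    from *[OF this] show ?thesis by (subst power2_commute)
  qed (auto intro: *)
qed

lemma increment_product_integrable:
  "integrable M (\<lambda>\<omega>. (B b \<omega> - B a \<omega>) * (B d \<omega> - B c \<omega>))"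
proof (rule Bochner_Integration.integrable_bound)
  show "integrable M (\<lambda>\<omega>. (B b \<omega> - B a \<omega>)\<^sup>2 + (B d \<omega> - B c \<omega>)\<^sup>2)"
    by (intro Bochner_Integration.integrable_add increment_square_integrable)
  have "\<bar>x * y\<bar> \<le> x\<^sup>2 + y\<^sup>2" for x y :: real
  proof -
    have "2 * (\<bar>x\<bar> * \<bar>y\<bar>) \<le> x\<^sup>2 + y\<^sup>2" using sum_squares_bound[of "\<bar>x\<bar>" "\<bar>y\<bar>"] by simp
    moreover have "0 \<le> \<bar>x\<bar> * \<bar>y\<bar>" by simp
    ultimately show ?thesis unfolding abs_mult by linarith
  qed
  then show "AE \<omega> in M. norm ((B b \<omega> - B a \<omega>) * (B d \<omega> - B c \<omega>))
      \<le> norm ((B b \<omega> - B a \<omega>)\<^sup>2 + (B d \<omega> - B c \<omega>)\<^sup>2)" by auto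
qed measurable

lemma integrable_bounded_mult:
  fixes \<zeta> X :: "'a \<Rightarrow> real"
  assumes "\<zeta> \<in> borel_measurable M" "\<And>\<omega>. \<omega> \<in> space M \<Longrightarrow> \<bar>\<zeta> \<omega>\<bar> \<le> C" "integrable M X"
  shows "integrable M (\<lambda>\<omega>. \<zeta> \<omega> * X \<omega>)"
proof (rule Bochner_Integration.integrable_bound)
  show "integrable M (\<lambda>\<omega>. C * X \<omega>)" using assms by simp
  show "AE \<omega> in M. norm (\<zeta> \<omega> * X \<omega>) \<le> norm (C * X \<omega>)"
    using assms(2) by (intro AE_I2) (fastforce simp: abs_mult intro: mult_right_mono)
qed (use assms in measurable)

text \<open>The independence of an increment from the past, applied to products.\<close>

lemma expectation_mult_function_of_increment:
  fixes Z :: "'a \<Rightarrow> real" and g :: "real \<Rightarrow> real"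
  assumes "s \<le> t" "Z \<in> borel_measurable (F s)" "integrable M Z" "g \<in> borel_measurable borel"
    "integrable M (\<lambda>\<omega>. g (B t \<omega> - B s \<omega>))"
  shows "expectation (\<lambda>\<omega>. Z \<omega> * g (B t \<omega> - B s \<omega>))
    = expectation Z * expectation (\<lambda>\<omega>. g (B t \<omega> - B s \<omega>))"
proof -
  let ?X = "\<lambda>\<omega>. B t \<omega> - B s \<omega>"
  let ?A = "{?X -` A \<inter> space M | A. A \<in> sets borel}"
  have ind: "indep_set ?A (sets (F s))"
    using increment_indep_B[of "t - s" s] assms(1) by simp
  have gX: "(\<lambda>\<omega>. g (?X \<omega>)) \<in> borel_measurable M"
    using assms(4) by measurable
  have "indep_var borel Z borel (\<lambda>\<omega>. g (?X \<omega>))"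
    unfolding indep_var_eq
  proof (intro conjI F_measurable_imp_measurable[OF assms(2)] gX indep_set_sigma_sets)
    show "indep_set {Z -` A \<inter> space M |A. A \<in> sets borel}
        {(\<lambda>\<omega>. g (?X \<omega>)) -` A \<inter> space M |A. A \<in> sets borel}"
      unfolding indep_sets2_eq
    proof (intro conjI ballI)
      show "{Z -` A \<inter> space M |A. A \<in> sets borel} \<subseteq> events"
        using F_measurable_imp_measurable[OF assms(2)] by (auto dest: measurable_sets)
      show "{(\<lambda>\<omega>. g (?X \<omega>)) -` A \<inter> space M |A. A \<in> sets borel} \<subseteq> events"
        using gX by (auto dest: measurable_sets)
    next
      fix U V assume U: "U \<in> {Z -` A \<inter> space M |A. A \<in> sets borel}"
        and V: "V \<in> {(\<lambda>\<omega>. g (?X \<omega>)) -` A \<inter> space M |A. A \<in> sets borel}"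
      have "U \<in> sets (F s)" using U assms(2) by (auto dest: measurable_sets simp: space_F)
      moreover have "V \<in> ?A"
      proof -
        obtain A where A: "A \<in> sets borel" "V = (\<lambda>\<omega>. g (?X \<omega>)) -` A \<inter> space M" using V by blast
        have "g -` A \<in> sets borel" using measurable_sets[OF assms(4) A(1)] by simp
        then show ?thesis unfolding A(2) by (intro CollectI exI[of _ "g -` A"]) auto
      qed
      ultimately show "prob (U \<inter> V) = prob U * prob V"
        using indep_setD[OF ind, of V U] by (simp add: Int_commute mult.commute)
    qed
    have stable: "Int_stable {W -` A \<inter> space M |A. A \<in> sets borel}" for W :: "'a \<Rightarrow> real"
    proof (rule Int_stableI)
      fix a b assume "a \<in> {W -` A \<inter> space M |A. A \<in> sets borel}"
        "b \<in> {W -` A \<inter> space M |A. A \<in> sets borel}"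
      then obtain A A' where "A \<in> sets borel" "A' \<in> sets borel"
        "a = W -` A \<inter> space M" "b = W -` A' \<inter> space M" by blast
      then show "a \<inter> b \<in> {W -` A \<inter> space M |A. A \<in> sets borel}"
        by (intro CollectI exI[of _ "A \<inter> A'"]) auto
    qed
    show "Int_stable {Z -` A \<inter> space M |A. A \<in> sets borel}" by (rule stable)
    show "Int_stable {(\<lambda>\<omega>. g (?X \<omega>)) -` A \<inter> space M |A. A \<in> sets borel}" by (rule stable)
  qed
  then show ?thesis by (intro indep_var_lebesgue_integral assms)
qed

lemma expectation_disjoint_increments:
  assumes "a \<le> b" "b \<le> c" "c \<le> d" and \<zeta>: "\<zeta> \<in> borel_measurable (F c)"
    and C: "\<And>\<omega>. \<omega> \<in> space M \<Longrightarrow> \<bar>\<zeta> \<omega>\<bar> \<le> C"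
  shows "expectation (\<lambda>\<omega>. \<zeta> \<omega> * ((B b \<omega> - B a \<omega>) * (B d \<omega> - B c \<omega>))) = 0"
proof -
  have "expectation (\<lambda>\<omega>. (\<zeta> \<omega> * (B b \<omega> - B a \<omega>)) * (B d \<omega> - B c \<omega>))
      = expectation (\<lambda>\<omega>. \<zeta> \<omega> * (B b \<omega> - B a \<omega>)) * expectation (\<lambda>\<omega>. B d \<omega> - B c \<omega>)"
    using assms
    by (intro expectation_mult_function_of_increment[where g="\<lambda>x. x"] borel_measurable_times
          F_measurable_mono[OF increment_F_measurable] increment_integrable
          integrable_bounded_mult[OF F_measurable_imp_measurable]) auto
  then show ?thesis by (simp add: increment_mean mult.assoc)
qed

text \<open>The shorter of two increments with the same starting point splits off from the longer one.\<close>

lemma expectation_increments_same_start: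
  assumes "c \<le> m" "m \<le> d" and \<zeta>: "\<zeta> \<in> borel_measurable (F c)"
    and C: "\<And>\<omega>. \<omega> \<in> space M \<Longrightarrow> \<bar>\<zeta> \<omega>\<bar> \<le> C"
  shows "expectation (\<lambda>\<omega>. \<zeta> \<omega> * ((B m \<omega> - B c \<omega>) * (B d \<omega> - B c \<omega>))) = expectation \<zeta> * (m - c)"
proof -
  note \<zeta>M = F_measurable_imp_measurable[OF \<zeta>]
  have int\<zeta>: "integrable M \<zeta>"
    using integrable_bounded_mult[OF \<zeta>M C, of "\<lambda>_. 1"] by simp
  have "expectation (\<lambda>\<omega>. \<zeta> \<omega> * ((B m \<omega> - B c \<omega>) * (B d \<omega> - B c \<omega>)))
      = expectation (\<lambda>\<omega>. \<zeta> \<omega> * ((B m \<omega> - B c \<omega>) * (B m \<omega> - B c \<omega>))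
          + \<zeta> \<omega> * ((B m \<omega> - B c \<omega>) * (B d \<omega> - B m \<omega>)))"
    by (rule arg_cong[where f=expectation]) (simp add: fun_eq_iff algebra_simps)
  also have "\<dots> = expectation (\<lambda>\<omega>. \<zeta> \<omega> * ((B m \<omega> - B c \<omega>) * (B m \<omega> - B c \<omega>)))
      + expectation (\<lambda>\<omega>. \<zeta> \<omega> * ((B m \<omega> - B c \<omega>) * (B d \<omega> - B m \<omega>)))"
    by (intro Bochner_Integration.integral_add integrable_bounded_mult[OF \<zeta>M C]
        increment_product_integrable)
  also have "expectation (\<lambda>\<omega>. \<zeta> \<omega> * ((B m \<omega> - B c \<omega>) * (B d \<omega> - B m \<omega>))) = 0"
    using assms by (intro expectation_disjoint_increments[OF _ _ _ F_measurable_mono[OF \<zeta>] C]) auto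
  also have "expectation (\<lambda>\<omega>. \<zeta> \<omega> * ((B m \<omega> - B c \<omega>) * (B m \<omega> - B c \<omega>)))
      = expectation \<zeta> * expectation (\<lambda>\<omega>. (B m \<omega> - B c \<omega>)\<^sup>2)"
    using expectation_mult_function_of_increment[OF assms(1) \<zeta> int\<zeta>, of "\<lambda>x. x\<^sup>2"]
      increment_square_integrable[of m c] by (simp add: power2_eq_square)
  finally show ?thesis using assms(1) by (simp add: increment_second_moment)
qed

lemma expectation_increments_ordered:
  assumes "a \<le> b" "c \<le> d" "a \<le> c" and \<zeta>: "\<zeta> \<in> borel_measurable (F c)"
    and C: "\<And>\<omega>. \<omega> \<in> space M \<Longrightarrow> \<bar>\<zeta> \<omega>\<bar> \<le> C"
  shows "expectation (\<lambda>\<omega>. \<zeta> \<omega> * ((B b \<omega> - B a \<omega>) * (B d \<omega> - B c \<omega>)))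
    = expectation \<zeta> * measure lborel ({a<..b} \<inter> {c<..d})"
proof (cases "b \<le> c")
  case True
  have empty: "{a<..b} \<inter> {c<..d} = {}" using True by (auto simp only: disjoint_iff greaterThanAtMost_iff)
  have "measure lborel ({a<..b} \<inter> {c<..d}) = 0" unfolding empty by (rule measure_empty)
  then show ?thesis using expectation_disjoint_increments[OF assms(1) True assms(2) \<zeta> C] by simp
next
  case False
  note \<zeta>M = F_measurable_imp_measurable[OF \<zeta>]
  have set: "{a<..b} \<inter> {c<..d} = {c<..min b d}" using False assms by auto
  have "expectation (\<lambda>\<omega>. \<zeta> \<omega> * ((B b \<omega> - B a \<omega>) * (B d \<omega> - B c \<omega>)))
      = expectation (\<lambda>\<omega>. \<zeta> \<omega> * ((B c \<omega> - B a \<omega>) * (B d \<omega> - B c \<omega>))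
          + \<zeta> \<omega> * ((B b \<omega> - B c \<omega>) * (B d \<omega> - B c \<omega>)))"
    by (rule arg_cong[where f=expectation]) (simp add: fun_eq_iff algebra_simps)
  also have "\<dots> = expectation (\<lambda>\<omega>. \<zeta> \<omega> * ((B c \<omega> - B a \<omega>) * (B d \<omega> - B c \<omega>)))
      + expectation (\<lambda>\<omega>. \<zeta> \<omega> * ((B b \<omega> - B c \<omega>) * (B d \<omega> - B c \<omega>)))"
    by (intro Bochner_Integration.integral_add integrable_bounded_mult[OF \<zeta>M C]
        increment_product_integrable)
  also have "expectation (\<lambda>\<omega>. \<zeta> \<omega> * ((B c \<omega> - B a \<omega>) * (B d \<omega> - B c \<omega>))) = 0"
    using assms by (intro expectation_disjoint_increments[OF _ _ _ \<zeta> C]) auto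
  also have "expectation (\<lambda>\<omega>. \<zeta> \<omega> * ((B b \<omega> - B c \<omega>) * (B d \<omega> - B c \<omega>)))
      = expectation \<zeta> * (min b d - c)"
  proof (cases "b \<le> d")
    case True
    then show ?thesis using False expectation_increments_same_start[OF _ True \<zeta> C] by simp
  next
    case bd: False
    then show ?thesis
      using expectation_increments_same_start[of c d b, OF assms(2) _ \<zeta> C]
      by (simp add: mult.commute)
  qed
  finally show ?thesis using False assms by (simp add: set)
qed

text \<open>The polarised isometry for one pair of elementary integrands. The two intervals may overlap in any
  way, so that no common refinement of two simple processes is needed below.\<close>

lemma expectation_increments:
  assumes "a \<le> b" "c \<le> d" and \<xi>: "\<xi> \<in> borel_measurable (F a)" and \<eta>: "\<eta> \<in> borel_measurable (F c)"
    and "\<And>\<omega>. \<omega> \<in> space M \<Longrightarrow> \<bar>\<xi> \<omega>\<bar> \<le> C" "\<And>\<omega>. \<omega> \<in> space M \<Longrightarrow> \<bar>\<eta> \<omega>\<bar> \<le> C'"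
  shows "expectation (\<lambda>\<omega>. (\<xi> \<omega> * (B b \<omega> - B a \<omega>)) * (\<eta> \<omega> * (B d \<omega> - B c \<omega>)))
    = expectation (\<lambda>\<omega>. \<xi> \<omega> * \<eta> \<omega>) * measure lborel ({a<..b} \<inter> {c<..d})"
proof -
  have C: "\<bar>\<xi> \<omega> * \<eta> \<omega>\<bar> \<le> C * C'" if "\<omega> \<in> space M" for \<omega>
    unfolding abs_mult using assms(5,6)[OF that] by (intro mult_mono) auto
  have eq: "(\<lambda>\<omega>. (\<xi> \<omega> * (B b \<omega> - B a \<omega>)) * (\<eta> \<omega> * (B d \<omega> - B c \<omega>)))
      = (\<lambda>\<omega>. (\<xi> \<omega> * \<eta> \<omega>) * ((B b \<omega> - B a \<omega>) * (B d \<omega> - B c \<omega>)))" by (simp add: fun_eq_iff)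
  show ?thesis
  proof (cases "a \<le> c")
    case True
    then show ?thesis unfolding eq using assms C
      by (intro expectation_increments_ordered borel_measurable_times F_measurable_mono[OF \<xi>]) auto
  next
    case False
    then have "expectation (\<lambda>\<omega>. (\<xi> \<omega> * \<eta> \<omega>) * ((B d \<omega> - B c \<omega>) * (B b \<omega> - B a \<omega>)))
       = expectation (\<lambda>\<omega>. \<xi> \<omega> * \<eta> \<omega>) * measure lborel ({c<..d} \<inter> {a<..b})" using assms C
      by (intro expectation_increments_ordered borel_measurable_times F_measurable_mono[OF \<eta>]) auto
    then show ?thesis unfolding eq by (simp add: mult.commute Int_commute)
  qed
qed

lemma elementary_isometry:
  fixes a b :: "'i \<Rightarrow> real" and \<zeta> :: "'i \<Rightarrow> 'a \<Rightarrow> real"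
  assumes "finite J" and ab: "\<And>j. j \<in> J \<Longrightarrow> a j \<le> b j"
    and \<zeta>: "\<And>j. j \<in> J \<Longrightarrow> \<zeta> j \<in> borel_measurable (F (a j))"
    and bdd: "\<And>j. j \<in> J \<Longrightarrow> \<exists>C. \<forall>\<omega>\<in>space M. \<bar>\<zeta> j \<omega>\<bar> \<le> C"
  shows "(\<integral>\<^sup>+\<omega>. ennreal ((\<Sum>j\<in>J. \<zeta> j \<omega> * (B (b j) \<omega> - B (a j) \<omega>))\<^sup>2) \<partial>M)
    = (\<integral>\<^sup>+\<omega>. (\<integral>\<^sup>+s. ennreal ((\<Sum>j\<in>J. \<zeta> j \<omega> * indicator {a j<..b j} s)\<^sup>2) \<partial>lborel) \<partial>M)"
proof -
  let ?\<mu> = "\<lambda>j k. measure lborel ({a j<..b j} \<inter> {a k<..b k})"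
  obtain C where C: "\<And>j \<omega>. j \<in> J \<Longrightarrow> \<omega> \<in> space M \<Longrightarrow> \<bar>\<zeta> j \<omega>\<bar> \<le> C j" using bdd by metis
  note \<zeta>M = F_measurable_imp_measurable[OF \<zeta>]
  let ?X = "\<lambda>j \<omega>. \<zeta> j \<omega> * (B (b j) \<omega> - B (a j) \<omega>)"
  have C2: "\<bar>\<zeta> j \<omega> * \<zeta> k \<omega>\<bar> \<le> C j * C k" if "j \<in> J" "k \<in> J" "\<omega> \<in> space M" for j k \<omega>
    unfolding abs_mult using C[OF that(1,3)] C[OF that(2,3)] by (intro mult_mono) auto
  have int\<zeta>: "integrable M (\<lambda>\<omega>. \<zeta> j \<omega> * \<zeta> k \<omega>)" if "j \<in> J" "k \<in> J" for j k
    using integrable_bounded_mult[of "\<lambda>\<omega>. \<zeta> j \<omega> * \<zeta> k \<omega>" _ "\<lambda>_. 1"] C2 \<zeta>M that by force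
  have intX: "integrable M (\<lambda>\<omega>. ?X j \<omega> * ?X k \<omega>)" if "j \<in> J" "k \<in> J" for j k
  proof -
    have "integrable M (\<lambda>\<omega>. (\<zeta> j \<omega> * \<zeta> k \<omega>) * ((B (b j) \<omega> - B (a j) \<omega>) * (B (b k) \<omega> - B (a k) \<omega>)))"
      using that \<zeta>M by (intro integrable_bounded_mult[OF _ C2] increment_product_integrable) auto
    then show ?thesis by (simp add: mult_ac)
  qed
  have "(\<integral>\<^sup>+\<omega>. ennreal ((\<Sum>j\<in>J. ?X j \<omega>)\<^sup>2) \<partial>M) = ennreal (expectation (\<lambda>\<omega>. (\<Sum>j\<in>J. ?X j \<omega>)\<^sup>2))"
    unfolding power2_eq_square sum_product
    by (intro nn_integral_eq_integral Bochner_Integration.integrable_sum intX AE_I2)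
       (auto simp: sum_product[symmetric])
  also have "expectation (\<lambda>\<omega>. (\<Sum>j\<in>J. ?X j \<omega>)\<^sup>2) = (\<Sum>j\<in>J. \<Sum>k\<in>J. expectation (\<lambda>\<omega>. ?X j \<omega> * ?X k \<omega>))"
    unfolding power2_eq_square sum_product
    by (simp add: Bochner_Integration.integral_sum intX)
  also have "\<dots> = (\<Sum>j\<in>J. \<Sum>k\<in>J. expectation (\<lambda>\<omega>. \<zeta> j \<omega> * \<zeta> k \<omega>) * ?\<mu> j k)"
    by (intro sum.cong refl expectation_increments[OF ab ab \<zeta> \<zeta> C C]) auto
  also have "\<dots> = expectation (\<lambda>\<omega>. \<Sum>j\<in>J. \<Sum>k\<in>J. \<zeta> j \<omega> * \<zeta> k \<omega> * ?\<mu> j k)"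
    by (simp add: Bochner_Integration.integral_sum int\<zeta>)
  finally have lhs: "(\<integral>\<^sup>+\<omega>. ennreal ((\<Sum>j\<in>J. ?X j \<omega>)\<^sup>2) \<partial>M)
      = ennreal (expectation (\<lambda>\<omega>. \<Sum>j\<in>J. \<Sum>k\<in>J. \<zeta> j \<omega> * \<zeta> k \<omega> * ?\<mu> j k))" .
  have inner: "(\<integral>\<^sup>+s. ennreal ((\<Sum>j\<in>J. z j * indicator {a j<..b j} s)\<^sup>2) \<partial>lborel)
      = ennreal (\<Sum>j\<in>J. \<Sum>k\<in>J. z j * z k * ?\<mu> j k)"
    and inner_nonneg: "0 \<le> (\<Sum>j\<in>J. \<Sum>k\<in>J. z j * z k * ?\<mu> j k)" for z :: "'i \<Rightarrow> real"
  proof -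
    have eq: "(\<Sum>j\<in>J. z j * indicator {a j<..b j} s)\<^sup>2
        = (\<Sum>j\<in>J. \<Sum>k\<in>J. z j * z k * indicator ({a j<..b j} \<inter> {a k<..b k}) s)" for s
      unfolding power2_eq_square sum_product by (simp only: indicator_inter_arith mult_ac)
    have fin: "emeasure lborel ({a j<..b j} \<inter> {a k<..b k}) < \<infinity>" for j k
      by (rule le_less_trans[OF emeasure_mono[of _ "{a j..b j}"]])
         (auto simp: emeasure_lborel_Icc_eq)
    have hb: "has_bochner_integral lborel (\<lambda>s. \<Sum>j\<in>J. \<Sum>k\<in>J. z j * z k * indicator ({a j<..b j} \<inter> {a k<..b k}) s)
        (\<Sum>j\<in>J. \<Sum>k\<in>J. z j * z k * ?\<mu> j k)"
      by (intro has_bochner_integral_sum has_bochner_integral_mult_right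
          has_bochner_integral_real_indicator fin) auto
    have nn: "0 \<le> (\<Sum>j\<in>J. \<Sum>k\<in>J. z j * z k * indicator ({a j<..b j} \<inter> {a k<..b k}) s)" for s
      by (simp only: eq[symmetric] zero_le_power2)
    show "(\<integral>\<^sup>+s. ennreal ((\<Sum>j\<in>J. z j * indicator {a j<..b j} s)\<^sup>2) \<partial>lborel)
      = ennreal (\<Sum>j\<in>J. \<Sum>k\<in>J. z j * z k * ?\<mu> j k)"
      unfolding eq has_bochner_integral_integral_eq[OF hb, symmetric]
      by (intro nn_integral_eq_integral AE_I2 nn integrable.intros[OF hb])
    show "0 \<le> (\<Sum>j\<in>J. \<Sum>k\<in>J. z j * z k * ?\<mu> j k)"
      unfolding has_bochner_integral_integral_eq[OF hb, symmetric]
      by (intro Bochner_Integration.integral_nonneg nn)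
  qed
  show ?thesis
    unfolding lhs inner
    by (intro nn_integral_eq_integral[symmetric] Bochner_Integration.integrable_sum
        Bochner_Integration.integrable_mult_left int\<zeta> AE_I2 inner_nonneg) 
qed

text \<open>The difference of two simple processes is again a finite sum of elementary integrands, indexed by
  the disjoint union of the two index sets.\<close>

lemma simple_integral_diff_isometry:
  assumes "simple_coeffs M F n r \<xi>" "simple_coeffs M F m q \<eta>"
  shows "(\<integral>\<^sup>+\<omega>. ennreal ((simple_integral B n r \<xi> \<omega> - simple_integral B m q \<eta> \<omega>)\<^sup>2) \<partial>M)
    = (\<integral>\<^sup>+\<omega>. (\<integral>\<^sup>+s. ennreal ((simple_process n r \<xi> s \<omega> - simple_process m q \<eta> s \<omega>)\<^sup>2) \<partial>lborel) \<partial>M)"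
proof -
  define J where "J = {..<n} <+> {..<m}"
  define a where "a = case_sum r q"
  define b where "b = case_sum (\<lambda>i. r (Suc i)) (\<lambda>i. q (Suc i))"
  define \<zeta> where "\<zeta> = case_sum \<xi> (\<lambda>i \<omega>. - \<eta> i \<omega>)"
  have "simple_integral B n r \<xi> \<omega> - simple_integral B m q \<eta> \<omega>
      = (\<Sum>j\<in>J. \<zeta> j \<omega> * (B (b j) \<omega> - B (a j) \<omega>))" for \<omega>
    unfolding simple_integral_def J_def a_def b_def \<zeta>_def
    by (subst sum.Plus)
       (simp_all only: o_def sum.case mult_minus_left sum_negf finite_lessThan diff_conv_add_uminus[of "sum _ _"])
  moreover have "simple_process n r \<xi> s \<omega> - simple_process m q \<eta> s \<omega>
      = (\<Sum>j\<in>J. \<zeta> j \<omega> * indicator {a j<..b j} s)" for s \<omega>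
    unfolding simple_process_def J_def a_def b_def \<zeta>_def
    by (subst sum.Plus)
       (simp_all only: o_def sum.case mult_minus_left sum_negf finite_lessThan diff_conv_add_uminus[of "sum _ _"])
  moreover have "finite J" by (simp add: J_def)
  moreover have "a j \<le> b j" "\<zeta> j \<in> borel_measurable (F (a j))"
    "\<exists>C. \<forall>\<omega>\<in>space M. \<bar>\<zeta> j \<omega>\<bar> \<le> C" if "j \<in> J" for j
    using that assms by (auto simp: J_def a_def b_def \<zeta>_def simple_coeffs_def)
  ultimately show ?thesis using elementary_isometry[of J a b \<zeta>] by (simp only:)
qed

lemma simple_process_measurable:
  assumes "simple_coeffs M F n r \<xi>"
  shows "(\<lambda>(s, \<omega>). simple_process n r \<xi> s \<omega>) \<in> borel_measurable (lborel \<Otimes>\<^sub>M M)"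
proof -
  have [measurable]: "\<xi> i \<in> borel_measurable M" if "i < n" for i
    using assms that by (intro F_measurable_imp_measurable[of _ "r i"]) (auto simp: simple_coeffs_def)
  have "(\<lambda>x. \<Sum>i<n. \<xi> i (snd x) * indicator {r i<..r (Suc i)} (fst x))
      \<in> borel_measurable (lborel \<Otimes>\<^sub>M M)"
    by (intro borel_measurable_sum) measurable
  then show ?thesis by (simp add: simple_process_def case_prod_beta)
qed

lemma simple_integral_measurable:
  assumes "simple_coeffs M F n r \<xi>"
  shows "simple_integral B n r \<xi> \<in> borel_measurable M"
proof -
  have [measurable]: "\<xi> i \<in> borel_measurable M" if "i < n" for i
    using assms that by (intro F_measurable_imp_measurable[of _ "r i"]) (auto simp: simple_coeffs_def)
  have "(\<lambda>\<omega>. \<Sum>i<n. \<xi> i \<omega> * (B (r (Suc i)) \<omega> - B (r i) \<omega>)) \<in> borel_measurable M"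
    by (intro borel_measurable_sum) measurable
  then show ?thesis by (simp add: simple_integral_def[abs_def])
qed

end

lemma nn_integral_square_sum3_le:
  fixes f g h :: "'b \<Rightarrow> real"
  assumes [measurable]: "f \<in> borel_measurable N" "g \<in> borel_measurable N" "h \<in> borel_measurable N"
  shows "(\<integral>\<^sup>+x. ennreal ((f x + g x + h x)\<^sup>2) \<partial>N)
    \<le> 3 * ((\<integral>\<^sup>+x. ennreal ((f x)\<^sup>2) \<partial>N) + (\<integral>\<^sup>+x. ennreal ((g x)\<^sup>2) \<partial>N) + (\<integral>\<^sup>+x. ennreal ((h x)\<^sup>2) \<partial>N))"
proof -
  have *: "(a + b + c)\<^sup>2 \<le> 3 * (a\<^sup>2 + b\<^sup>2 + c\<^sup>2)" for a b c :: real
    using sum_squares_bound[of a b] sum_squares_bound[of b c] sum_squares_bound[of a c]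
    by (simp add: power2_eq_square algebra_simps)
  have "(\<integral>\<^sup>+x. ennreal ((f x + g x + h x)\<^sup>2) \<partial>N)
      \<le> (\<integral>\<^sup>+x. 3 * (ennreal ((f x)\<^sup>2) + ennreal ((g x)\<^sup>2) + ennreal ((h x)\<^sup>2)) \<partial>N)"
  proof (rule nn_integral_mono)
    fix x
    have "ennreal ((f x + g x + h x)\<^sup>2) \<le> ennreal (3 * ((f x)\<^sup>2 + (g x)\<^sup>2 + (h x)\<^sup>2))"
      by (intro ennreal_leI *)
    then show "ennreal ((f x + g x + h x)\<^sup>2)
        \<le> 3 * (ennreal ((f x)\<^sup>2) + ennreal ((g x)\<^sup>2) + ennreal ((h x)\<^sup>2))"
      by (simp add: ennreal_mult ennreal_plus)
  qed
  also have "\<dots> = 3 * ((\<integral>\<^sup>+x. ennreal ((f x)\<^sup>2) \<partial>N) + (\<integral>\<^sup>+x. ennreal ((g x)\<^sup>2) \<partial>N)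
      + (\<integral>\<^sup>+x. ennreal ((h x)\<^sup>2) \<partial>N))"
    by (simp add: nn_integral_cmult nn_integral_add)
  finally show ?thesis .
qed

text \<open>The isometry for differences, as an inequality with a constant. The factor \<open>9\<close> comes from applying
  \<open>(a + b + c)\<^sup>2 \<le> 3 * (a\<^sup>2 + b\<^sup>2 + c\<^sup>2)\<close> twice instead of the triangle inequality.\<close>

lemma (in two_sided_brownian_motion) has_ito_integral_diff_second_moment:
  assumes "has_ito_integral M F B H X" "has_ito_integral M F B H' X'"
  shows "(\<integral>\<^sup>+\<omega>. ennreal ((X \<omega> - X' \<omega>)\<^sup>2) \<partial>M)
    \<le> 9 * (\<integral>\<^sup>+s. (\<integral>\<^sup>+\<omega>. ennreal ((H s \<omega> - H' s \<omega>)\<^sup>2) \<partial>M) \<partial>lborel)"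
proof -
  interpret P: pair_sigma_finite lborel M ..
  let ?P = "lborel \<Otimes>\<^sub>M M"
  have [measurable]: "(\<lambda>(s, \<omega>). H s \<omega>) \<in> borel_measurable ?P"
    "(\<lambda>(s, \<omega>). H' s \<omega>) \<in> borel_measurable ?P"
    "X \<in> borel_measurable M" "X' \<in> borel_measurable M"
    using assms unfolding has_ito_integral_def by auto
  obtain n r \<xi> where coeffs: "\<And>k. simple_coeffs M F (n k) (r k) (\<xi> k)"
    and S: "(\<lambda>k. \<integral>\<^sup>+\<omega>. (\<integral>\<^sup>+s. ennreal ((simple_process (n k) (r k) (\<xi> k) s \<omega> - H s \<omega>)\<^sup>2) \<partial>lborel) \<partial>M) \<longlonglongrightarrow> 0"
    and I: "(\<lambda>k. \<integral>\<^sup>+\<omega>. ennreal ((simple_integral B (n k) (r k) (\<xi> k) \<omega> - X \<omega>)\<^sup>2) \<partial>M) \<longlonglongrightarrow> 0"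
    using assms(1) unfolding has_ito_integral_def by blast
  obtain n' r' \<xi>' where coeffs': "\<And>k. simple_coeffs M F (n' k) (r' k) (\<xi>' k)"
    and S': "(\<lambda>k. \<integral>\<^sup>+\<omega>. (\<integral>\<^sup>+s. ennreal ((simple_process (n' k) (r' k) (\<xi>' k) s \<omega> - H' s \<omega>)\<^sup>2) \<partial>lborel) \<partial>M) \<longlonglongrightarrow> 0"
    and I': "(\<lambda>k. \<integral>\<^sup>+\<omega>. ennreal ((simple_integral B (n' k) (r' k) (\<xi>' k) \<omega> - X' \<omega>)\<^sup>2) \<partial>M) \<longlonglongrightarrow> 0"
    using assms(2) unfolding has_ito_integral_def by blast
  define s where "s k = (\<lambda>(s, \<omega>). simple_process (n k) (r k) (\<xi> k) s \<omega>)" for k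
  define s' where "s' k = (\<lambda>(s, \<omega>). simple_process (n' k) (r' k) (\<xi>' k) s \<omega>)" for k
  define i where "i k = simple_integral B (n k) (r k) (\<xi> k)" for k
  define i' where "i' k = simple_integral B (n' k) (r' k) (\<xi>' k)" for k
  define h where "h = (\<lambda>(s, \<omega>). H s \<omega>)"
  define h' where "h' = (\<lambda>(s, \<omega>). H' s \<omega>)"
  have [measurable]: "s k \<in> borel_measurable ?P" "s' k \<in> borel_measurable ?P"
    "i k \<in> borel_measurable M" "i' k \<in> borel_measurable M"
    "h \<in> borel_measurable ?P" "h' \<in> borel_measurable ?P" for k
    using simple_process_measurable[OF coeffs] simple_process_measurable[OF coeffs']
      simple_integral_measurable[OF coeffs] simple_integral_measurable[OF coeffs']
    unfolding s_def s'_def i_def i'_def h_def h'_def by auto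
  have swap: "(\<integral>\<^sup>+\<omega>. (\<integral>\<^sup>+s. ennreal ((u (s, \<omega>) - v (s, \<omega>))\<^sup>2) \<partial>lborel) \<partial>M) = (\<integral>\<^sup>+x. ennreal ((u x - v x)\<^sup>2) \<partial>?P)"
    if [measurable]: "u \<in> borel_measurable ?P" "v \<in> borel_measurable ?P" for u v
    by (rule P.nn_integral_snd) measurable
  let ?E = "\<lambda>k. \<integral>\<^sup>+x. ennreal ((s k x - h x)\<^sup>2) \<partial>?P" and ?E' = "\<lambda>k. \<integral>\<^sup>+x. ennreal ((s' k x - h' x)\<^sup>2) \<partial>?P"
  let ?G = "\<lambda>k. \<integral>\<^sup>+\<omega>. ennreal ((i k \<omega> - X \<omega>)\<^sup>2) \<partial>M" and ?G' = "\<lambda>k. \<integral>\<^sup>+\<omega>. ennreal ((i' k \<omega> - X' \<omega>)\<^sup>2) \<partial>M"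
  let ?D = "\<integral>\<^sup>+x. ennreal ((h x - h' x)\<^sup>2) \<partial>?P"
  have E: "?E \<longlonglongrightarrow> 0" "?E' \<longlonglongrightarrow> 0"
  proof -
    have "?E k = (\<integral>\<^sup>+\<omega>. (\<integral>\<^sup>+s. ennreal ((simple_process (n k) (r k) (\<xi> k) s \<omega> - H s \<omega>)\<^sup>2) \<partial>lborel) \<partial>M)"
      for k by (subst swap[of "s k" h, symmetric]) (measurable, simp only: s_def h_def prod.case)
    moreover have "?E' k = (\<integral>\<^sup>+\<omega>. (\<integral>\<^sup>+s. ennreal ((simple_process (n' k) (r' k) (\<xi>' k) s \<omega> - H' s \<omega>)\<^sup>2) \<partial>lborel) \<partial>M)"
      for k by (subst swap[of "s' k" h', symmetric]) (measurable, simp only: s'_def h'_def prod.case)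
    ultimately show "?E \<longlonglongrightarrow> 0" "?E' \<longlonglongrightarrow> 0" using S S' by simp_all
  qed
  have G: "?G \<longlonglongrightarrow> 0" "?G' \<longlonglongrightarrow> 0" using I I' by (simp_all add: i_def i'_def)
  have bound: "(\<integral>\<^sup>+\<omega>. ennreal ((X \<omega> - X' \<omega>)\<^sup>2) \<partial>M) \<le> 3 * (?G k + 3 * (?E k + ?D + ?E' k) + ?G' k)" for k
  proof -
    have "(\<integral>\<^sup>+\<omega>. ennreal ((i k \<omega> - i' k \<omega>)\<^sup>2) \<partial>M) = (\<integral>\<^sup>+x. ennreal ((s k x - s' k x)\<^sup>2) \<partial>?P)"
      unfolding i_def i'_def simple_integral_diff_isometry[OF coeffs coeffs']
      by (subst swap[of "s k" "s' k", symmetric]) (measurable, simp only: s_def s'_def prod.case)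
    also have "\<dots> = (\<integral>\<^sup>+x. ennreal (((s k x - h x) + (h x - h' x) + (h' x - s' k x))\<^sup>2) \<partial>?P)" by simp
    also have "\<dots> \<le> 3 * (?E k + ?D + (\<integral>\<^sup>+x. ennreal ((h' x - s' k x)\<^sup>2) \<partial>?P))"
      by (intro nn_integral_square_sum3_le) measurable
    also have "(\<integral>\<^sup>+x. ennreal ((h' x - s' k x)\<^sup>2) \<partial>?P) = ?E' k" by (simp add: power2_commute)
    finally have mid: "(\<integral>\<^sup>+\<omega>. ennreal ((i k \<omega> - i' k \<omega>)\<^sup>2) \<partial>M) \<le> 3 * (?E k + ?D + ?E' k)" .
    have "(\<integral>\<^sup>+\<omega>. ennreal ((X \<omega> - X' \<omega>)\<^sup>2) \<partial>M)
        = (\<integral>\<^sup>+\<omega>. ennreal (((X \<omega> - i k \<omega>) + (i k \<omega> - i' k \<omega>) + (i' k \<omega> - X' \<omega>))\<^sup>2) \<partial>M)" by simp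
    also have "\<dots> \<le> 3 * ((\<integral>\<^sup>+\<omega>. ennreal ((X \<omega> - i k \<omega>)\<^sup>2) \<partial>M)
        + (\<integral>\<^sup>+\<omega>. ennreal ((i k \<omega> - i' k \<omega>)\<^sup>2) \<partial>M) + ?G' k)"
      by (intro nn_integral_square_sum3_le) measurable
    also have "(\<integral>\<^sup>+\<omega>. ennreal ((X \<omega> - i k \<omega>)\<^sup>2) \<partial>M) = ?G k" by (simp add: power2_commute)
    also have "3 * (?G k + (\<integral>\<^sup>+\<omega>. ennreal ((i k \<omega> - i' k \<omega>)\<^sup>2) \<partial>M) + ?G' k)
        \<le> 3 * (?G k + 3 * (?E k + ?D + ?E' k) + ?G' k)"
      by (intro mult_left_mono add_mono mid order_refl) simp
    finally show ?thesis .
  qed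
  have "(\<lambda>k. 3 * (?G k + 3 * (?E k + ?D + ?E' k) + ?G' k)) \<longlonglongrightarrow> 3 * (0 + 3 * (0 + ?D + 0) + 0)"
    by (intro ennreal_tendsto_cmult tendsto_add E G tendsto_const) auto
  then have "(\<integral>\<^sup>+\<omega>. ennreal ((X \<omega> - X' \<omega>)\<^sup>2) \<partial>M) \<le> 3 * (0 + 3 * (0 + ?D + 0) + 0)"
    using bound by (intro LIMSEQ_le_const) auto
  also have "\<dots> = 9 * ?D" by (simp add: mult.assoc[symmetric])
  also have "?D = (\<integral>\<^sup>+s. (\<integral>\<^sup>+\<omega>. ennreal ((H s \<omega> - H' s \<omega>)\<^sup>2) \<partial>M) \<partial>lborel)"
    by (subst nn_integral_fst[symmetric]) (measurable, simp only: h_def h'_def prod.case)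
  finally show ?thesis .
qed

section \<open>The increments of the kernel\<close>

text \<open>As \<open>\<zeta> \<ge> 3/2\<close>, the derivative \<open>L'\<close> is integrable at infinity, so that \<open>L\<close> is bounded, and
  \<open>L' x * x\<close> tends to \<open>0\<close>.\<close>

lemma kernel_bounds:
  fixes L L' :: "real \<Rightarrow> real"
  assumes L: "\<And>s. 0 \<le> s \<Longrightarrow> (L has_real_derivative L' s) (at s within {0..})"
    and L'_cont: "continuous_on {0..} L'"
    and decay: "L' \<in> O[at_top](\<lambda>s. s powr - \<zeta>)" and \<zeta>: "3/2 \<le> \<zeta>"
  shows "\<exists>K\<ge>0. \<forall>x\<ge>0. \<bar>L x\<bar> \<le> K \<and> \<bar>L' x\<bar> * x \<le> K"
proof -
  from decay obtain c where c: "c > 0" "\<forall>\<^sub>F x in at_top. norm (L' x) \<le> c * norm (x powr - \<zeta>)"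
    by (rule landau_o.bigE)
  then obtain A0 where A0: "\<And>x. x \<ge> A0 \<Longrightarrow> \<bar>L' x\<bar> \<le> c * x powr - \<zeta>"
    by (auto simp: eventually_at_top_linorder)
  define A where "A = max 1 A0"
  have A: "1 \<le> A" by (simp add: A_def)
  have L'A: "\<bar>L' x\<bar> \<le> c * x powr (-3/2)" if "A \<le> x" for x
  proof -
    have "x powr - \<zeta> \<le> x powr (-3/2)" using that A \<zeta> by (intro powr_mono) auto
    then show ?thesis using A0[of x] that c(1)
      by (intro order.trans[OF A0 mult_left_mono]) (auto simp: A_def)
  qed
  have L_cont: "continuous_on {0..} L"
    using L by (intro DERIV_continuous_on[of _ _ L']) auto
  have "compact (L ` {0..A})" "compact ((\<lambda>x. L' x * x) ` {0..A})"
    by (intro compact_continuous_image continuous_intros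
        continuous_on_subset[OF L_cont] continuous_on_subset[OF L'_cont]; force)+
  then have "bounded (L ` {0..A})" "bounded ((\<lambda>x. L' x * x) ` {0..A})"
    by (simp_all only: compact_imp_bounded)
  then obtain K1 K2 where "\<forall>x\<in>{0..A}. \<bar>L x\<bar> \<le> K1" "\<forall>x\<in>{0..A}. \<bar>L' x * x\<bar> \<le> K2"
    unfolding bounded_iff ball_simps real_norm_def by blast
  then have K: "\<And>x. 0 \<le> x \<Longrightarrow> x \<le> A \<Longrightarrow> \<bar>L x\<bar> \<le> K1"
    "\<And>x. 0 \<le> x \<Longrightarrow> x \<le> A \<Longrightarrow> \<bar>L' x * x\<bar> \<le> K2" by auto
  \<comment> \<open>adding or subtracting an antiderivative of \<open>c * z powr (-3/2)\<close> makes \<open>L\<close> monotone\<close>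
  have LA: "\<bar>L x - L A\<bar> \<le> 2 * c" if x: "A \<le> x" for x
  proof -
    have der: "(L has_real_derivative L' z) (at z)" if "A \<le> z" for z
      using L[of z] that A at_within_interior[of z "{0::real..}"] by (auto simp: interior_real_atLeast)
    have der2: "((\<lambda>z. 2 * c * z powr (-1/2)) has_real_derivative - (c * z powr (-3/2))) (at z)"
      if "A \<le> z" for z
      using that A by (auto intro!: derivative_eq_intros)
    have "L x + 2 * c * x powr (-1/2) \<le> L A + 2 * c * A powr (-1/2)"
    proof (rule DERIV_nonpos_imp_nonincreasing[OF x])
      fix z assume z: "A \<le> z" "z \<le> x"
      show "\<exists>y. ((\<lambda>z. L z + 2 * c * z powr (-1/2)) has_real_derivative y) (at z) \<and> y \<le> 0"
        using DERIV_add[OF der der2, OF z(1) z(1)] L'A[OF z(1)]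
        by (intro exI[of _ "L' z + - (c * z powr (-3/2))"]) auto
    qed
    moreover have "L A - 2 * c * A powr (-1/2) \<le> L x - 2 * c * x powr (-1/2)"
    proof (rule DERIV_nonneg_imp_nondecreasing[OF x])
      fix z assume z: "A \<le> z" "z \<le> x"
      show "\<exists>y. ((\<lambda>z. L z - 2 * c * z powr (-1/2)) has_real_derivative y) (at z) \<and> y \<ge> 0"
        using DERIV_diff[OF der der2, OF z(1) z(1)] L'A[OF z(1)]
        by (intro exI[of _ "L' z - - (c * z powr (-3/2))"]) auto
    qed
    moreover have "0 \<le> 2 * c * x powr (-1/2)" using c(1) by simp
    moreover have "2 * c * A powr (-1/2) \<le> 2 * c"
    proof -
      have "A powr (-1/2) \<le> A powr 0" using A by (intro powr_mono) auto
      then show ?thesis using c(1) A by simp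
    qed
    ultimately show ?thesis by linarith
  qed
  define K where "K = max (K1 + 2 * c) (max K2 c)"
  have K0: "0 \<le> K" using c(1) by (auto simp: K_def)
  moreover have "\<bar>L x\<bar> \<le> K \<and> \<bar>L' x\<bar> * x \<le> K" if x: "0 \<le> x" for x
  proof (cases "x \<le> A")
    case True
    then show ?thesis using K[OF x True] x c(1) by (auto simp: K_def abs_mult)
  next
    case False
    have "\<bar>L' x\<bar> * x \<le> c * x powr (-3/2) * x" using L'A[of x] False x by (intro mult_right_mono) auto
    also have "\<dots> = c * x powr (-1/2)"
      using powr_add[of x "-3/2" 1] False A by simp
    also have "\<dots> \<le> c * x powr 0" using False A c(1) by (intro mult_left_mono powr_mono) auto
    finally have "\<bar>L' x\<bar> * x \<le> K" using False A by (simp add: K_def)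
    moreover have "\<bar>L x\<bar> \<le> K" using LA[of x] K(1)[of A] A False by (auto simp: K_def)
    ultimately show ?thesis by simp
  qed
  ultimately show ?thesis by blast
qed

lemma nn_integral_powr_tail:
  fixes h \<alpha> :: real
  assumes "0 < h" "\<alpha> < 1/2"
  shows "(\<integral>\<^sup>+x. ennreal (x powr (2 * \<alpha> - 2)) * indicator {h..} x \<partial>lborel)
    = ennreal (h powr (2 * \<alpha> - 1) / (1 - 2 * \<alpha>))"
proof -
  have "(\<integral>\<^sup>+x. ennreal (x powr (2 * \<alpha> - 2)) * indicator {h..} x \<partial>lborel)
      = ennreal (0 - - (h powr (2 * \<alpha> - 1) / (1 - 2 * \<alpha>)))"
  proof (rule nn_integral_FTC_atLeast)
    fix x assume "h \<le> x"
    have "((\<lambda>x. - (x powr (2 * \<alpha> - 1) / (1 - 2 * \<alpha>))) has_real_derivative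
        - ((2 * \<alpha> - 1) * x powr (2 * \<alpha> - 1 - 1) / (1 - 2 * \<alpha>))) (at x)"
      using \<open>h \<le> x\<close> assms by (auto intro!: derivative_eq_intros)
    also have "- ((2 * \<alpha> - 1) * x powr (2 * \<alpha> - 1 - 1) / (1 - 2 * \<alpha>)) = x powr (2 * \<alpha> - 2)"
      using assms by (simp add: field_simps)
    finally show "((\<lambda>x. - (x powr (2 * \<alpha> - 1) / (1 - 2 * \<alpha>))) has_real_derivative
        x powr (2 * \<alpha> - 2)) (at x)" .
  next
    have "((\<lambda>x. - (x powr (2 * \<alpha> - 1) / (1 - 2 * \<alpha>))) \<longlongrightarrow> - (0 / (1 - 2 * \<alpha>))) at_top"
      using assms by (intro tendsto_minus tendsto_divide tendsto_neg_powr filterlim_ident tendsto_const) auto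
    then show "((\<lambda>x. - (x powr (2 * \<alpha> - 1) / (1 - 2 * \<alpha>))) \<longlongrightarrow> 0) at_top" by simp
  qed auto
  then show ?thesis by simp
qed

text \<open>With \<open>h = t - s\<close> and \<open>x = s - u\<close>, the integrand is bounded by \<open>h powr (2 * \<alpha>)\<close>, up to a constant, on the interval
  \<open>[-h, h]\<close> around the singularity, and by \<open>h\<^sup>2 * x powr (2 * \<alpha> - 2)\<close> beyond it, by the mean
  value theorem. Both parts contribute the order \<open>h powr (2 * \<alpha> + 1)\<close>; the second integral
  converges as \<open>\<alpha> < 1/2\<close>.\<close>

lemma kernel_L2_increment:
  fixes g :: "real \<Rightarrow> real"
  assumes \<alpha>: "0 < \<alpha>" "\<alpha> < 1/2" and K: "0 \<le> K"
    and [measurable]: "g \<in> borel_measurable borel"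
    and g0: "\<And>x. x < 0 \<Longrightarrow> g x = 0"
    and g: "\<And>x. 0 \<le> x \<Longrightarrow> \<bar>g x\<bar> \<le> K * x powr \<alpha>"
    and g': "\<And>x. 0 < x \<Longrightarrow> \<exists>D. (g has_real_derivative D) (at x) \<and> \<bar>D\<bar> \<le> K * x powr (\<alpha> - 1)"
    and st: "s \<le> t"
  shows "(\<integral>\<^sup>+u. ennreal ((g (t - u) - g (s - u))\<^sup>2) \<partial>lborel)
    \<le> ennreal ((8 * K\<^sup>2 * 2 powr (2 * \<alpha>) + K\<^sup>2 / (1 - 2 * \<alpha>)) * (t - s) powr (2 * \<alpha> + 1))"
proof (cases "s = t")
  case False
  define h where "h = t - s"
  have h: "0 < h" using False st by (simp add: h_def)
  obtain D where D: "\<And>x. 0 < x \<Longrightarrow> (g has_real_derivative D x) (at x)"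
    "\<And>x. 0 < x \<Longrightarrow> \<bar>D x\<bar> \<le> K * x powr (\<alpha> - 1)" using g' by metis
  have far: "(g (x + h) - g x)\<^sup>2 \<le> (K * h)\<^sup>2 * x powr (2 * \<alpha> - 2)" if x: "h \<le> x" for x
  proof -
    obtain z where z: "x < z" "z < x + h" "g (x + h) - g x = (x + h - x) * D z"
      using MVT2[of x "x + h" g D] x h D(1) by auto
    have "\<bar>D z\<bar> \<le> K * x powr (\<alpha> - 1)"
      using x h z K \<alpha> by (intro order.trans[OF D(2)] mult_left_mono powr_mono2') auto
    then have "\<bar>g (x + h) - g x\<bar> \<le> h * (K * x powr (\<alpha> - 1))"
      using h by (simp add: z(3) abs_mult)
    then have "\<bar>g (x + h) - g x\<bar>\<^sup>2 \<le> (h * (K * x powr (\<alpha> - 1)))\<^sup>2"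
      by (intro power_mono) auto
    also have "\<dots> = (K * h)\<^sup>2 * (x powr (\<alpha> - 1))\<^sup>2" by (simp add: power_mult_distrib)
    also have "(x powr (\<alpha> - 1))\<^sup>2 = x powr (2 * \<alpha> - 2)"
      by (simp add: power2_eq_square powr_add[symmetric])
    finally show ?thesis by simp
  qed
  have near: "(g (x + h) - g x)\<^sup>2 \<le> 4 * K\<^sup>2 * (2 * h) powr (2 * \<alpha>)" if x: "x \<le> h" "- h \<le> x" for x
  proof -
    have b: "\<bar>g y\<bar> \<le> K * (2 * h) powr \<alpha>" if "y \<le> 2 * h" for y
    proof (cases "y < 0")
      case False
      then show ?thesis using that \<alpha> K h
        by (intro order.trans[OF g] mult_left_mono powr_mono2) auto
    qed (simp add: g0 K)
    have "\<bar>g (x + h) - g x\<bar> \<le> 2 * (K * (2 * h) powr \<alpha>)"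
      using b[of "x + h"] b[of x] x h by auto
    then have "\<bar>g (x + h) - g x\<bar>\<^sup>2 \<le> (2 * (K * (2 * h) powr \<alpha>))\<^sup>2"
      by (intro power_mono) auto
    also have "\<dots> = 4 * K\<^sup>2 * (2 * h) powr (2 * \<alpha>)"
      by (simp add: power_mult_distrib) (simp add: power2_eq_square powr_add[symmetric])
    finally show ?thesis by simp
  qed
  have "(\<integral>\<^sup>+u. ennreal ((g (t - u) - g (s - u))\<^sup>2) \<partial>lborel)
      = (\<integral>\<^sup>+x. ennreal ((g (x + h) - g x)\<^sup>2) \<partial>lborel)"
    by (subst nn_integral_real_affine[where c="-1" and t=s]) (auto simp: h_def algebra_simps)
  also have "\<dots> \<le> (\<integral>\<^sup>+x. ennreal (4 * K\<^sup>2 * (2 * h) powr (2 * \<alpha>)) * indicator {-h..h} x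
      + ennreal ((K * h)\<^sup>2) * (ennreal (x powr (2 * \<alpha> - 2)) * indicator {h..} x) \<partial>lborel)"
  proof (rule nn_integral_mono)
    fix x
    consider "x < -h" | "-h \<le> x" "x \<le> h" | "h < x" by linarith
    then show "ennreal ((g (x + h) - g x)\<^sup>2)
        \<le> ennreal (4 * K\<^sup>2 * (2 * h) powr (2 * \<alpha>)) * indicator {-h..h} x
          + ennreal ((K * h)\<^sup>2) * (ennreal (x powr (2 * \<alpha> - 2)) * indicator {h..} x)"
    proof cases
      case 1
      then show ?thesis using h g0[of x] g0[of "x + h"] by simp
    next
      case 2
      then show ?thesis using near[of x] by (simp add: ennreal_leI add_increasing2)
    next
      case 3
      then show ?thesis using far[of x] by (simp add: ennreal_mult[symmetric] ennreal_leI add_increasing)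
    qed
  qed
  also have "\<dots> = ennreal (4 * K\<^sup>2 * (2 * h) powr (2 * \<alpha>)) * ennreal (2 * h)
      + ennreal ((K * h)\<^sup>2) * ennreal (h powr (2 * \<alpha> - 1) / (1 - 2 * \<alpha>))"
    using h by (simp add: nn_integral_add nn_integral_cmult nn_integral_cmult_indicator
        nn_integral_powr_tail[OF h \<alpha>(2)])
  also have "\<dots> = ennreal (4 * K\<^sup>2 * (2 * h) powr (2 * \<alpha>) * (2 * h)
      + (K * h)\<^sup>2 * (h powr (2 * \<alpha> - 1) / (1 - 2 * \<alpha>)))"
    using h K \<alpha> by (simp add: ennreal_mult[symmetric] ennreal_plus[symmetric] del: ennreal_plus)
  also have "4 * K\<^sup>2 * (2 * h) powr (2 * \<alpha>) * (2 * h) = 8 * K\<^sup>2 * 2 powr (2 * \<alpha>) * h powr (2 * \<alpha> + 1)"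
    using h by (simp add: powr_mult powr_add)
  also have "(K * h)\<^sup>2 * (h powr (2 * \<alpha> - 1) / (1 - 2 * \<alpha>)) = K\<^sup>2 / (1 - 2 * \<alpha>) * h powr (2 * \<alpha> + 1)"
  proof -
    have "h powr (2 * \<alpha> + 1) = h powr (2 * \<alpha> - 1) * h\<^sup>2"
      using powr_add[of h "2 * \<alpha> - 1" 2] h by (simp add: powr_numeral add.commute)
    then show ?thesis by (simp add: power_mult_distrib)
  qed
  finally show ?thesis by (simp add: h_def distrib_right)
qed simp

section \<open>Moments of increments and variation\<close>

lemma powr_le_truncated:
  fixes x l p :: real
  assumes "0 < l" "0 < p" "p \<le> 2"
  shows "\<bar>x\<bar> powr p \<le> l powr p + l powr (p - 2) * x\<^sup>2"
proof (cases "\<bar>x\<bar> \<le> l")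
  case True
  then have "\<bar>x\<bar> powr p \<le> l powr p" using assms by (intro powr_mono2) auto
  then show ?thesis by (simp add: add_increasing2)
next
  case False
  have "\<bar>x\<bar> powr p = \<bar>x\<bar> powr (p - 2) * \<bar>x\<bar> powr 2"
    unfolding powr_add[symmetric] by simp
  also have "\<dots> = \<bar>x\<bar> powr (p - 2) * x\<^sup>2" using False assms by (simp add: powr_numeral)
  also have "\<dots> \<le> l powr (p - 2) * x\<^sup>2"
    using False assms by (intro mult_right_mono powr_mono2') auto
  finally show ?thesis by (simp add: add_increasing)
qed

text \<open>Jensen's inequality up to a constant, by truncation at the level \<open>h powr H\<close>.\<close>

lemma (in prob_space) absolute_moment_le:
  assumes [measurable]: "X \<in> borel_measurable M"
    and X: "(\<integral>\<^sup>+\<omega>. ennreal ((X \<omega>)\<^sup>2) \<partial>M) \<le> ennreal (C * h powr (2 * H))"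
    and "0 \<le> C" "0 < h" "0 < p" "p \<le> 2"
  shows "(\<integral>\<^sup>+\<omega>. ennreal (\<bar>X \<omega>\<bar> powr p) \<partial>M) \<le> ennreal ((1 + C) * h powr (H * p))"
proof -
  let ?l = "h powr H"
  have "(\<integral>\<^sup>+\<omega>. ennreal (\<bar>X \<omega>\<bar> powr p) \<partial>M)
      \<le> (\<integral>\<^sup>+\<omega>. ennreal (?l powr p) + ennreal (?l powr (p - 2)) * ennreal ((X \<omega>)\<^sup>2) \<partial>M)"
    using assms powr_le_truncated[of ?l p]
    by (intro nn_integral_mono) (auto simp: ennreal_mult[symmetric] ennreal_plus[symmetric]
        simp del: ennreal_plus intro!: ennreal_leI)
  also have "\<dots> = ennreal (?l powr p) + ennreal (?l powr (p - 2)) * (\<integral>\<^sup>+\<omega>. ennreal ((X \<omega>)\<^sup>2) \<partial>M)"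
    by (simp add: nn_integral_add nn_integral_cmult emeasure_space_1)
  also have "\<dots> \<le> ennreal (?l powr p) + ennreal (?l powr (p - 2)) * ennreal (C * h powr (2 * H))"
    by (intro add_left_mono mult_left_mono X) auto
  also have "\<dots> = ennreal (?l powr p + ?l powr (p - 2) * (C * h powr (2 * H)))"
    using assms(3) by (simp add: ennreal_mult[symmetric] ennreal_plus[symmetric] del: ennreal_plus)
  also have "?l powr p + ?l powr (p - 2) * (C * h powr (2 * H)) = (1 + C) * h powr (H * p)"
  proof -
    have "?l powr (p - 2) * h powr (2 * H) = h powr (H * p)"
      by (simp add: powr_powr powr_add[symmetric] algebra_simps)
    then show ?thesis by (simp add: powr_powr algebra_simps)
  qed
  finally show ?thesis .
qed

text \<open>The weight is chosen such that the \<open>n\<close>-th term has expectation at most a constant times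
  \<open>(1/q)^n\<close>: there are \<open>2^n\<close> intervals, and \<open>2 powr \<gamma> = 2 * q\<^sup>2\<close>.\<close>

lemma AE_summable_dyadic_var:
  fixes Y :: "real \<Rightarrow> 'a \<Rightarrow> real"
  assumes "0 < T" "0 \<le> D" "1 < \<gamma>"
    and [measurable]: "\<And>t. Y t \<in> borel_measurable M"
    and mom: "\<And>s t. s < t \<Longrightarrow>
      (\<integral>\<^sup>+\<omega>. ennreal (\<bar>Y t \<omega> - Y s \<omega>\<bar> powr p) \<partial>M) \<le> ennreal (D * (t - s) powr \<gamma>)"
  shows "AE \<omega> in M. summable (\<lambda>n. (2 powr ((\<gamma> - 1) / 2))^n * dyadic_var T p (\<lambda>t. Y t \<omega>) n 0 T)"
proof -
  define q where "q = 2 powr ((\<gamma> - 1) / 2)"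
  have q: "0 < q" by (simp add: q_def)
  let ?V = "\<lambda>n \<omega>. q^n * dyadic_var T p (\<lambda>t. Y t \<omega>) n 0 T"
  have [measurable]: "?V n \<in> borel_measurable M" for n
    unfolding dyadic_var_def by measurable
  have V: "(\<integral>\<^sup>+\<omega>. ennreal (?V n \<omega>) \<partial>M) \<le> ennreal (D * T powr \<gamma> * (1/q)^n)" for n
  proof -
    let ?I = "\<lambda>k \<omega>. \<bar>Y (real (Suc k) * T / 2^n) \<omega> - Y (real k * T / 2^n) \<omega>\<bar> powr p"
    have "(\<integral>\<^sup>+\<omega>. ennreal (?V n \<omega>) \<partial>M) \<le> (\<integral>\<^sup>+\<omega>. ennreal (q^n) * (\<Sum>k<2^n. ennreal (?I k \<omega>)) \<partial>M)"
    proof (rule nn_integral_mono)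
      fix \<omega>
      have "dyadic_var T p (\<lambda>t. Y t \<omega>) n 0 T \<le> (\<Sum>k<2^n. ?I k \<omega>)"
        unfolding dyadic_var_def by (intro sum_mono2) auto
      then have "ennreal (?V n \<omega>) \<le> ennreal (q^n * (\<Sum>k<2^n. ?I k \<omega>))"
        using q by (intro ennreal_leI mult_left_mono) auto
      also have "\<dots> = ennreal (q^n) * (\<Sum>k<2^n. ennreal (?I k \<omega>))"
        using q by (subst ennreal_mult) (auto intro!: sum_nonneg)
      finally show "ennreal (?V n \<omega>) \<le> ennreal (q^n) * (\<Sum>k<2^n. ennreal (?I k \<omega>))" .
    qed
    also have "\<dots> = ennreal (q^n) * (\<Sum>k<2^n. \<integral>\<^sup>+\<omega>. ennreal (?I k \<omega>) \<partial>M)"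
      by (subst nn_integral_cmult, measurable, subst nn_integral_sum) auto
    also have "\<dots> \<le> ennreal (q^n) * (\<Sum>k<(2::nat)^n. ennreal (D * (T / 2^n) powr \<gamma>))"
    proof (intro mult_left_mono sum_mono)
      fix k
      have d: "real (Suc k) * T / 2^n - real k * T / 2^n = T / 2^n"
        by (simp add: diff_divide_distrib[symmetric] algebra_simps)
      have "0 < T / 2^n" using assms(1) by simp
      then show "(\<integral>\<^sup>+\<omega>. ennreal (?I k \<omega>) \<partial>M) \<le> ennreal (D * (T / 2^n) powr \<gamma>)"
        using mom[of "real k * T / 2^n" "real (Suc k) * T / 2^n"] d
        by (simp del: of_nat_Suc) 
    qed auto
    also have "\<dots> = ennreal (q^n * (2^n * (D * (T / 2^n) powr \<gamma>)))"
      using q assms(2) by (simp add: ennreal_mult ennreal_of_nat_eq_real_of_nat)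
    also have "q^n * (2^n * (D * (T / 2^n) powr \<gamma>)) = D * T powr \<gamma> * (1/q)^n"
    proof -
      have "(T / 2^n) powr \<gamma> = T powr \<gamma> / (2 powr \<gamma>)^n"
        using assms(1) by (simp add: powr_divide powr_realpow[symmetric] powr_powr mult.commute)
      moreover have "2 powr \<gamma> = 2 * q * q" by (simp add: q_def powr_add[symmetric] powr_mult_base)
      ultimately show ?thesis using q by (simp add: power_mult_distrib power_divide)
    qed
    finally show ?thesis .
  qed
  have "1 < q" using assms(3) by (simp add: q_def)
  then have sum: "summable (\<lambda>n. D * T powr \<gamma> * (1/q)^n)"
    by (intro summable_mult summable_geometric) auto
  have "(\<integral>\<^sup>+\<omega>. (\<Sum>n. ennreal (?V n \<omega>)) \<partial>M) = (\<Sum>n. \<integral>\<^sup>+\<omega>. ennreal (?V n \<omega>) \<partial>M)"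
    by (rule nn_integral_suminf) measurable
  also have "\<dots> \<le> (\<Sum>n. ennreal (D * T powr \<gamma> * (1/q)^n))"
    by (intro suminf_le V summableI)
  also have "\<dots> = ennreal (\<Sum>n. D * T powr \<gamma> * (1/q)^n)"
    using assms(2) q by (intro suminf_ennreal2 sum) auto
  also have "\<dots> < \<infinity>" by simp
  finally have "AE \<omega> in M. (\<Sum>n. ennreal (?V n \<omega>)) \<noteq> \<infinity>"
    by (intro nn_integral_PInf_AE) auto
  then show ?thesis
    unfolding q_def[symmetric]
  proof (eventually_elim)
    case (elim \<omega>)
    then show ?case using q
      by (intro summable_suminf_not_top) (auto simp: dyadic_var_nonneg)
  qed
qed

section \<open>Moving averages\<close>

text \<open>The kernel \<open>g\<close> is a function on the whole line; causality is the case in which it vanishes on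
  the negative half-line.\<close>

lemma (in two_sided_brownian_motion) moving_average_increment_second_moment:
  fixes g :: "real \<Rightarrow> real"
  assumes Y: "\<And>t. has_ito_integral M F B (\<lambda>u \<omega>. g (t - u) * \<sigma> u \<omega>) (Y t)"
    and g: "g \<in> borel_measurable borel"
    and \<sigma>: "\<And>t. \<sigma> t \<in> borel_measurable M" "\<And>t. (\<integral>\<^sup>+\<omega>. ennreal ((\<sigma> t \<omega>)\<^sup>2) \<partial>M) \<le> S"
  shows "(\<integral>\<^sup>+\<omega>. ennreal ((Y t \<omega> - Y s \<omega>)\<^sup>2) \<partial>M)
    \<le> 9 * S * (\<integral>\<^sup>+u. ennreal ((g (t - u) - g (s - u))\<^sup>2) \<partial>lborel)"
proof -
  note [measurable] = g \<sigma>(1)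
  have "(\<integral>\<^sup>+\<omega>. ennreal ((Y t \<omega> - Y s \<omega>)\<^sup>2) \<partial>M)
      \<le> 9 * (\<integral>\<^sup>+u. (\<integral>\<^sup>+\<omega>. ennreal ((g (t - u) * \<sigma> u \<omega> - g (s - u) * \<sigma> u \<omega>)\<^sup>2) \<partial>M) \<partial>lborel)"
    by (rule has_ito_integral_diff_second_moment[OF Y Y])
  also have "\<dots> \<le> 9 * (\<integral>\<^sup>+u. S * ennreal ((g (t - u) - g (s - u))\<^sup>2) \<partial>lborel)"
  proof (intro mult_left_mono nn_integral_mono)
    fix u
    have "(\<integral>\<^sup>+\<omega>. ennreal ((g (t - u) * \<sigma> u \<omega> - g (s - u) * \<sigma> u \<omega>)\<^sup>2) \<partial>M)
        = (\<integral>\<^sup>+\<omega>. ennreal ((g (t - u) - g (s - u))\<^sup>2) * ennreal ((\<sigma> u \<omega>)\<^sup>2) \<partial>M)"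
      by (simp add: left_diff_distrib[symmetric] power_mult_distrib ennreal_mult)
    also have "\<dots> = ennreal ((g (t - u) - g (s - u))\<^sup>2) * (\<integral>\<^sup>+\<omega>. ennreal ((\<sigma> u \<omega>)\<^sup>2) \<partial>M)"
      by (rule nn_integral_cmult) measurable
    also have "\<dots> \<le> ennreal ((g (t - u) - g (s - u))\<^sup>2) * S"
      by (intro mult_left_mono \<sigma>(2)) simp
    finally show "(\<integral>\<^sup>+\<omega>. ennreal ((g (t - u) * \<sigma> u \<omega> - g (s - u) * \<sigma> u \<omega>)\<^sup>2) \<partial>M)
        \<le> S * ennreal ((g (t - u) - g (s - u))\<^sup>2)" by (simp add: mult.commute)
  qed simp
  also have "\<dots> = 9 * (S * (\<integral>\<^sup>+u. ennreal ((g (t - u) - g (s - u))\<^sup>2) \<partial>lborel))"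
    by (simp add: nn_integral_cmult)
  finally show ?thesis by (simp add: mult.assoc)
qed

theorem theorem2:
  fixes M :: "'a measure" and F :: "real \<Rightarrow> 'a measure"
    and B \<sigma> Y :: "real \<Rightarrow> 'a \<Rightarrow> real"
    and L L' L'' f f' :: "real \<Rightarrow> real"
    and \<alpha> \<beta> T \<zeta>\<^sub>0 :: real
  assumes "0 < \<alpha>" and "\<alpha> < 1/2" and "0 < T"
    and "two_sided_brownian_motion M F B"
    and "\<And>s. 0 \<le> s \<Longrightarrow> (L has_real_derivative L' s) (at s within {0..})"
    and "\<And>s. 0 \<le> s \<Longrightarrow> (L' has_real_derivative L'' s) (at s within {0..})"
    and "continuous_on {0..} L''"
    and "L 0 \<noteq> 0"
    and "set_integrable lborel {0..} (\<lambda>s. \<bar>L s * s powr \<alpha>\<bar>\<^sup>2)"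
    and "\<zeta>\<^sub>0 > \<alpha> + 3/2"
    and "L' \<in> O[at_top](\<lambda>s. s powr (- \<zeta>\<^sub>0))"
    and "L'' \<in> O[at_top](\<lambda>s. s powr (- (\<zeta>\<^sub>0 + 1)))"
    and "adapted F \<sigma>"
    and "stationary M \<sigma>"
    and "\<And>\<omega>. \<omega> \<in> space M \<Longrightarrow> caglad (\<lambda>t. \<sigma> t \<omega>)"
    and "(SUP t. \<integral>\<^sup>+\<omega>. ennreal ((\<sigma> t \<omega>)\<^sup>2) \<partial>M) < \<infinity>"
    and "\<And>t. has_ito_integral M F B
           (\<lambda>s \<omega>. indicator {..t} s * (L (t - s) * (t - s) powr \<alpha> * \<sigma> s \<omega>)) (Y t)"
    and "AE \<omega> in M. continuous_on {0..T} (\<lambda>t. Y t \<omega>)"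
    and "\<And>x. (f has_real_derivative f' x) (at x)"
    and "continuous_on UNIV f'"
    and "\<beta> > 1 / (\<alpha> + 1/2) - 1"
    and "\<exists>C. \<forall>x y. \<bar>f' x - f' y\<bar> \<le> C * \<bar>x - y\<bar> powr \<beta>"
  shows "AE \<omega> in M. pathwise_integrable T (\<lambda>s. f' (Y s \<omega>)) (\<lambda>s. Y s \<omega>) \<and>
           f (Y T \<omega>) = f (Y 0 \<omega>) + pathwise_integral T (\<lambda>s. f' (Y s \<omega>)) (\<lambda>s. Y s \<omega>)"
proof -
  interpret two_sided_brownian_motion M F B by fact
  define g where "g x = indicator {0..} x * (L x * x powr \<alpha>)" for x
  have g_nonneg: "g x = L x * x powr \<alpha>" if "0 \<le> x" for x using that by (simp add: g_def)
  have contL': "continuous_on {0..} L'"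
    by (rule DERIV_continuous_on[of _ _ L'']) (use assms(6) in auto)
  have contL: "continuous_on {0..} L"
    by (rule DERIV_continuous_on[of _ _ L']) (use assms(5) in auto)
  have g_meas [measurable]: "g \<in> borel_measurable borel"
  proof -
    have "(\<lambda>x. indicator {0..} x *\<^sub>R L x) \<in> borel_measurable borel"
      by (rule borel_measurable_continuous_on_indicator[OF _ contL]) simp
    then have "(\<lambda>x. (indicator {0..} x *\<^sub>R L x) * x powr \<alpha>) \<in> borel_measurable borel" by measurable
    then show ?thesis by (simp add: g_def[abs_def] mult.assoc)
  qed
  obtain K where K: "0 \<le> K" "\<And>x. 0 \<le> x \<Longrightarrow> \<bar>L x\<bar> \<le> K" "\<And>x. 0 \<le> x \<Longrightarrow> \<bar>L' x\<bar> * x \<le> K"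
    using kernel_bounds[OF assms(5) contL' assms(11)] assms(1,10) by auto
  have g_le: "\<bar>g x\<bar> \<le> 2 * K * x powr \<alpha>" if "0 \<le> x" for x
  proof -
    have "\<bar>L x\<bar> * x powr \<alpha> \<le> (2 * K) * x powr \<alpha>" using K(1) K(2)[OF that] by (intro mult_right_mono) auto
    then show ?thesis using that by (simp add: g_nonneg abs_mult)
  qed
  have g_deriv: "\<exists>D. (g has_real_derivative D) (at x) \<and> \<bar>D\<bar> \<le> 2 * K * x powr (\<alpha> - 1)" if x: "0 < x" for x
  proof (intro exI conjI)
    have "(L has_real_derivative L' x) (at x)"
      using assms(5)[of x] x at_within_interior[of x "{0::real..}"] by (auto simp: interior_real_atLeast)
    then have "((\<lambda>x. L x * x powr \<alpha>) has_real_derivative L' x * x powr \<alpha> + \<alpha> * x powr (\<alpha> - 1) * L x) (at x)"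
      using x by (auto intro!: DERIV_mult has_real_derivative_powr)
    then show "(g has_real_derivative L' x * x powr \<alpha> + \<alpha> * x powr (\<alpha> - 1) * L x) (at x)"
      by (rule has_field_derivative_transform_within_open[of _ _ _ "{0<..}"]) (use x in \<open>auto simp: g_nonneg\<close>)
    have "\<bar>L' x * x powr \<alpha>\<bar> = \<bar>L' x\<bar> * x * x powr (\<alpha> - 1)"
      using x by (simp add: abs_mult powr_mult_base mult.assoc)
    also have "\<dots> \<le> K * x powr (\<alpha> - 1)" using K(3)[of x] x by (intro mult_right_mono) auto
    finally have 1: "\<bar>L' x * x powr \<alpha>\<bar> \<le> K * x powr (\<alpha> - 1)" .
    have "\<alpha> * \<bar>L x\<bar> \<le> 1 * K" using K(2)[of x] x assms(1,2) by (intro mult_mono) auto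
    then have "\<alpha> * \<bar>L x\<bar> * x powr (\<alpha> - 1) \<le> K * x powr (\<alpha> - 1)" by (intro mult_right_mono) auto
    then have 2: "\<bar>\<alpha> * x powr (\<alpha> - 1) * L x\<bar> \<le> K * x powr (\<alpha> - 1)"
      using assms(1) by (simp add: abs_mult mult_ac)
    show "\<bar>L' x * x powr \<alpha> + \<alpha> * x powr (\<alpha> - 1) * L x\<bar> \<le> 2 * K * x powr (\<alpha> - 1)"
      using 1 2 by linarith
  qed
  define S where "S = (SUP t. \<integral>\<^sup>+\<omega>. ennreal ((\<sigma> t \<omega>)\<^sup>2) \<partial>M)"
  obtain S' where S': "0 \<le> S'" "S = ennreal S'"
    using assms(16) unfolding S_def[symmetric] by (cases S) auto
  have Y: "has_ito_integral M F B (\<lambda>u \<omega>. g (t - u) * \<sigma> u \<omega>) (Y t)" for t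
  proof -
    have "(\<lambda>u \<omega>. indicator {..t} u * (L (t - u) * (t - u) powr \<alpha> * \<sigma> u \<omega>)) = (\<lambda>u \<omega>. g (t - u) * \<sigma> u \<omega>)"
      by (auto simp: fun_eq_iff g_def indicator_def)
    then show ?thesis using assms(17)[of t] by simp
  qed
  have Y_meas [measurable]: "Y t \<in> borel_measurable M" for t
    using Y[of t] unfolding has_ito_integral_def by blast
  define C where "C = 8 * (2 * K)\<^sup>2 * 2 powr (2 * \<alpha>) + (2 * K)\<^sup>2 / (1 - 2 * \<alpha>)"
  have C: "0 \<le> C" using assms(2) by (simp add: C_def)
  define H where "H = \<alpha> + 1/2"
  have second: "(\<integral>\<^sup>+\<omega>. ennreal ((Y t \<omega> - Y s \<omega>)\<^sup>2) \<partial>M) \<le> ennreal (9 * S' * C * (t - s) powr (2 * H))"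
    if st: "s \<le> t" for s t
  proof -
    have "(\<integral>\<^sup>+\<omega>. ennreal ((Y t \<omega> - Y s \<omega>)\<^sup>2) \<partial>M)
        \<le> 9 * S * (\<integral>\<^sup>+u. ennreal ((g (t - u) - g (s - u))\<^sup>2) \<partial>lborel)"
    proof (rule moving_average_increment_second_moment[OF Y g_meas])
      show "\<sigma> t \<in> borel_measurable M" for t
        using assms(13) F_measurable_imp_measurable[of "\<sigma> t" t] by (simp add: adapted_def)
      show "(\<integral>\<^sup>+\<omega>. ennreal ((\<sigma> t \<omega>)\<^sup>2) \<partial>M) \<le> S" for t
        unfolding S_def by (rule SUP_upper) simp
    qed
    also have "(\<integral>\<^sup>+u. ennreal ((g (t - u) - g (s - u))\<^sup>2) \<partial>lborel) \<le> ennreal (C * (t - s) powr (2 * \<alpha> + 1))"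
      unfolding C_def
      by (rule kernel_L2_increment[OF assms(1,2) _ g_meas _ g_le g_deriv st]) (use K(1) in \<open>auto simp: g_def\<close>)
    finally have "(\<integral>\<^sup>+\<omega>. ennreal ((Y t \<omega> - Y s \<omega>)\<^sup>2) \<partial>M)
        \<le> 9 * S * ennreal (C * (t - s) powr (2 * \<alpha> + 1))" by (simp add: mult_left_mono)
    also have "\<dots> = ennreal (9 * S' * C * (t - s) powr (2 * H))"
      using S' C by (simp add: ennreal_mult H_def mult.assoc)
    finally show ?thesis .
  qed
  have "1 < 1 / (\<alpha> + 1/2)" using assms(1,2) by (simp add: field_simps)
  then have \<beta>: "0 \<le> \<beta>" using assms(21) by simp
  have H: "1 < 2 * H" "1 < H * (1 + \<beta>)"
    using assms(1,2,21) by (auto simp: H_def field_simps)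
  \<comment> \<open>an exponent that is small enough for second moments and still satisfies \<open>1 < H * p\<close>\<close>
  define p where "p = min 2 (1 + \<beta>)"
  have p: "0 < p" "p \<le> 2" "p \<le> 1 + \<beta>" "1 < H * p"
    using H \<beta> by (auto simp: p_def min_def mult.commute)
  have moment: "(\<integral>\<^sup>+\<omega>. ennreal (\<bar>Y t \<omega> - Y s \<omega>\<bar> powr p) \<partial>M) \<le> ennreal ((1 + 9 * S' * C) * (t - s) powr (H * p))"
    if "s < t" for s t
    using that S'(1) C p by (intro absolute_moment_le second) auto
  define q where "q = 2 powr ((H * p - 1) / 2)"
  have q: "1 < q" using p(4) by (simp add: q_def)
  obtain C' where C': "\<And>x y. \<bar>f' x - f' y\<bar> \<le> C' * \<bar>x - y\<bar> powr \<beta>" using assms(22) by blast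
  have "AE \<omega> in M. summable (\<lambda>n. q^n * dyadic_var T p (\<lambda>t. Y t \<omega>) n 0 T)"
    unfolding q_def
    by (rule AE_summable_dyadic_var[OF assms(3) _ p(4) Y_meas moment]) (use S'(1) C in auto)
  moreover note assms(18)
  ultimately show ?thesis
  proof eventually_elim
    case (elim \<omega>)
    have "has_pathwise_integral T (\<lambda>s. f' (Y s \<omega>)) (\<lambda>s. Y s \<omega>) (f (Y T \<omega>) - f (Y 0 \<omega>))"
      by (rule pathwise_ito_formula[OF assms(3) p(1,3) q \<beta> elim(2,1) assms(19) C'])
    then show ?case
      using pathwise_integral_eqI[OF assms(3)] by (auto simp: pathwise_integrable_def)
  qed
qed

end
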